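(* There is a constant $C<\infty$ such that for each connected $B\subset\mathcal{H}$ with $L_0\subset B$, each $x=(x_1,x_2)\in B\setminus L_0$, and every $N$ sufficiently larger than $x_2$ (i.e. every $N\ge N_0$ for some threshold $N_0$ depending only on $x_2$), $$H_{B,N}(x)\le C\,x_2^{1/2}.$$
   Context: $\mathcal{H}=\{(x_1,x_2)\in\mathbb{Z}^2: x_2\ge 0\}$ is the upper half plane and, for each integer $n\ge 0$, $L_n=\{(k,n):k\in\mathbb{Z}\}$. Connectedness is with respect to nearest-neighbor adjacency in $\mathbb{Z}^2$. $(S_n)_{n\ge 0}$ is simple random walk on $\mathbb{Z}^2$, $P_z$ is its law when $S_0=z$, and for $A\subset\mathbb{Z}^2$, $\bar\tau_A=\min\{n\ge 0:S_n\in A\}$. For $B\subset\mathcal{H}$, $x\in B$ and an integer $N\geq 1$, $$H_{B,N}(x)=\sum_{z\in L_N\setminus B}P_z\big(S_{\bar\tau_{B\cup L_0}}=x\big).$$ The constant $C$ does not depend on $B$, $x$ or $N$. *)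

theory Defs
  imports "HOL-Probability.Probability"
begin

type_synonym point = "int \<times> int"

definition upper_half_plane :: "point set"
  where "upper_half_plane = {(x1, x2). x2 \<ge> 0}"

definition L :: "nat \<Rightarrow> point set"
  where "L n = {(k, int n) | k. True}"

definition adjacent :: "point \<Rightarrow> point \<Rightarrow> bool"
  where "adjacent u v \<longleftrightarrow> \<bar>fst u - fst v\<bar> + \<bar>snd u - snd v\<bar> = 1"

definition lattice_connected :: "point set \<Rightarrow> bool"
  where "lattice_connected B \<longleftrightarrow>
    (\<forall>a\<in>B. \<forall>b\<in>B. (a, b) \<in> {(u, v). u \<in> B \<and> v \<in> B \<and> adjacent u v}\<^sup>*)"

definition step_pmf :: "point pmf"
  where "step_pmf = pmf_of_set {(1, 0), (-1, 0), (0, 1), (0, -1)}"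

definition steps :: "(nat \<Rightarrow> point) measure"
  where "steps = (\<Pi>\<^sub>M i\<in>UNIV. measure_pmf step_pmf)"

definition walk :: "point \<Rightarrow> (nat \<Rightarrow> point) \<Rightarrow> nat \<Rightarrow> point"
  where "walk z X n = z + (\<Sum>i<n. X i)"

text \<open>The law \<open>P\<^sub>z\<close> of simple random walk started at \<open>z\<close>, as a measure on trajectories.\<close>

definition srw :: "point \<Rightarrow> (nat \<Rightarrow> point) measure"
  where "srw z = distr steps (\<Pi>\<^sub>M i\<in>UNIV. count_space UNIV) (walk z)"

text \<open>The value is unspecified on trajectories that never visit \<open>A\<close>; those are excluded
  explicitly in \<open>stopped_at\<close>.\<close>

definition hitting_time :: "point set \<Rightarrow> (nat \<Rightarrow> point) \<Rightarrow> nat"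
  where "hitting_time A S = (LEAST n. S n \<in> A)"

definition stopped_at :: "point set \<Rightarrow> point \<Rightarrow> (nat \<Rightarrow> point) set"
  where "stopped_at A x = {S. (\<exists>n. S n \<in> A) \<and> S (hitting_time A S) = x}"

text \<open>The sum is over a possibly infinite set, hence taken in \<open>ennreal\<close>: it is \<open>\<infinity>\<close> when it
  diverges.\<close>

definition H :: "point set \<Rightarrow> nat \<Rightarrow> point \<Rightarrow> ennreal"
  where "H B N x = (\<Sum>\<^sub>\<infinity>z\<in>L N - B. emeasure (srw z) (stopped_at (B \<union> L 0) x))"

text \<open>\<open>distr\<close> and \<open>emeasure\<close> degenerate to \<open>0\<close> on non-measurable arguments; this does not
  occur here.\<close>

lemma walk_measurable: "walk z \<in> measurable steps (\<Pi>\<^sub>M i\<in>UNIV. count_space UNIV)"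
proof (rule measurable_PiM_single')
  fix n :: nat
  have X: "(\<lambda>X. X i) \<in> measurable steps (count_space UNIV)" for i :: nat
  proof -
    have "(\<lambda>X. X i) \<in> measurable steps (measure_pmf step_pmf)"
      unfolding steps_def by (rule measurable_component_singleton) simp
    then show ?thesis by (simp cong: measurable_cong_sets)
  qed
  have "(\<lambda>X. \<Sum>i<n. X i) \<in> measurable steps (count_space UNIV)"
  proof (induction n)
    case (Suc n)
    have "(\<lambda>X. (\<lambda>a b. a + b) (\<Sum>i<n. X i) (X n)) \<in> measurable steps (count_space UNIV)"
      by (rule measurable_compose_countable[OF measurable_compose_countable[OF _ Suc] X]) simp
    then show ?case by simp
  qed simp
  then show "(\<lambda>X. walk z X n) \<in> measurable steps (count_space UNIV)"
    unfolding walk_def by (rule measurable_compose) simp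
qed (auto simp: steps_def space_PiM)

lemma prob_space_srw: "prob_space (srw z)"
proof -
  have "prob_space steps"
    unfolding steps_def by (rule prob_space_PiM) (rule prob_space_measure_pmf)
  then show ?thesis
    unfolding srw_def by (rule prob_space.prob_space_distr) (rule walk_measurable)
qed

lemma stopped_at_sets: "stopped_at A x \<in> sets (srw z)"
proof -
  let ?M = "\<Pi>\<^sub>M i\<in>(UNIV :: nat set). count_space (UNIV :: point set)"
  have [measurable]: "(\<lambda>S. S n) \<in> measurable ?M (count_space UNIV)" for n
    by simp
  have "stopped_at A x =
    {S \<in> space ?M. \<exists>n. S n \<in> A \<and> S n = x \<and> (\<forall>m\<in>{..<n}. S m \<notin> A)}"
  proof (intro set_eqI iffI)
    fix S assume "S \<in> stopped_at A x"
    then have "S (hitting_time A S) \<in> A" "S (hitting_time A S) = x"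
      "\<forall>m\<in>{..<hitting_time A S}. S m \<notin> A"
      unfolding stopped_at_def hitting_time_def by (auto intro: LeastI dest: not_less_Least)
    then show "S \<in> {S \<in> space ?M. \<exists>n. S n \<in> A \<and> S n = x \<and> (\<forall>m\<in>{..<n}. S m \<notin> A)}"
      by (auto simp: space_PiM)
  next
    fix S assume "S \<in> {S \<in> space ?M. \<exists>n. S n \<in> A \<and> S n = x \<and> (\<forall>m\<in>{..<n}. S m \<notin> A)}"
    then obtain n where n: "S n \<in> A" "S n = x" "\<forall>m\<in>{..<n}. S m \<notin> A" by auto
    then have "hitting_time A S = n"
      unfolding hitting_time_def by (intro Least_equality) (auto simp: not_less[symmetric])
    with n show "S \<in> stopped_at A x" by (auto simp: stopped_at_def)
  qed
  also have "\<dots> \<in> sets ?M" by measurable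
  finally show ?thesis by (simp add: srw_def)
qed

end

theory Submission
  imports Defs
begin

text \<open>
  If \<open>F \<ge> 0\<close> on the upper half plane is discretely superharmonic off \<open>B\<close>, then optional stopping
  gives \<open>P\<^sub>z(S\<^sub>\<tau> = x) \<le> F z / F x\<close>, so it suffices to find such an \<open>F\<close> with \<open>F x\<close> bounded below and
  \<open>\<Sum>z\<in>L\<^sub>N. F z = O(x\<^sub>2\<^sup>1\<^sup>/\<^sup>2)\<close>.

  Write \<open>h = x\<^sub>2\<close>. As \<open>B\<close> joins \<open>x\<close> to \<open>L\<^sub>0\<close>, for every \<open>j < h/16\<close> it contains a point \<open>y\<^sub>j\<close> with
  \<open>j \<le> |y\<^sub>j - x| < j + 1\<close>. Take \<open>F = (1 + O(h\<^sup>-\<^sup>1\<^sup>/\<^sup>2)) G(x, \<cdot>) - \<Sum>\<^sub>j \<mu>\<^sub>j G(y\<^sub>j, \<cdot>)\<close>, where \<open>G\<close> is the Green kernel of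
  the half plane and \<open>\<mu>\<^sub>j\<close> is of order \<open>j\<^sup>-\<^sup>3\<^sup>/\<^sup>2\<close> with \<open>\<Sum>\<^sub>j \<mu>\<^sub>j = 1 - O(h\<^sup>-\<^sup>1\<^sup>/\<^sup>2)\<close>; it is superharmonic off the points
  \<open>y\<^sub>j \<in> B\<close>. Since \<open>|z - y\<^sub>j| \<ge> ||z - x| - |y\<^sub>j - x||\<close>, positivity of \<open>F\<close> near \<open>x\<close> reduces to an inequality for
  logarithmic potentials on a half-line, where \<open>v\<^sup>-\<^sup>3\<^sup>/\<^sup>2\<close> is the critical density. Away from \<open>x\<close> the
  kernels \<open>G(y\<^sub>j, \<cdot>)\<close> and \<open>G(x, \<cdot>)\<close> agree up to a factor \<open>1 + O(j/h)\<close>, so that \<open>F\<close> is nonnegative and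
  \<open>O(h\<^sup>-\<^sup>1\<^sup>/\<^sup>2) G(x, \<cdot>)\<close>, while \<open>\<Sum>z\<in>L\<^sub>N. G(x, z) = O(h)\<close>.

  The potential kernel is never needed: the explicit functions \<open>ln (|w|\<^sup>2 \<plusminus> 1/2) / 2\<close> are exactly
  subharmonic, respectively superharmonic off \<open>0\<close>, and each is used where its sign is harmless.
\<close>

subsection \<open>Hitting probabilities and superharmonic functions\<close>

definition nbr_sum :: "(point \<Rightarrow> real) \<Rightarrow> point \<Rightarrow> real" where
  "nbr_sum F z = F (z + (1, 0)) + F (z + (-1, 0)) + F (z + (0, 1)) + F (z + (0, -1))"

text \<open>Lives on increment sequences and caps the hitting time by \<open>n\<close>, so that
  first-step analysis becomes induction on \<open>n\<close>. The union over \<open>n\<close> is the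
  preimage of \<open>stopped_at A x\<close>.\<close>

definition hit_within :: "point set \<Rightarrow> point \<Rightarrow> nat \<Rightarrow> point \<Rightarrow> (nat \<Rightarrow> point) set" where
  "hit_within A x n z = {X. \<exists>k\<le>n. walk z X k = x \<and> x \<in> A \<and> (\<forall>m<k. walk z X m \<notin> A)}"

lemma space_steps [simp]: "space steps = UNIV"
  by (simp add: steps_def space_PiM)

lemma prob_space_steps: "prob_space steps"
  unfolding steps_def by (rule prob_space_PiM) (rule prob_space_measure_pmf)

lemma walk_component_measurable [measurable]:
  "(\<lambda>X. walk z X n) \<in> measurable steps (count_space UNIV)"
proof -
  have "(\<lambda>X. walk z X n) = (\<lambda>S. S n) \<circ> walk z"
    by auto
  moreover have "(\<lambda>S. S n) \<in> measurable (\<Pi>\<^sub>M i\<in>(UNIV :: nat set). count_space (UNIV :: point set))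
      (count_space UNIV)"
    by simp
  ultimately show ?thesis
    using walk_measurable measurable_comp by metis
qed

lemma hit_within_sets [measurable]: "hit_within A x n z \<in> sets steps"
proof -
  have "hit_within A x n z = {X \<in> space steps.
      \<exists>k\<in>{..n}. walk z X k = x \<and> x \<in> A \<and> (\<forall>m\<in>{..<k}. walk z X m \<notin> A)}"
    by (auto simp: hit_within_def)
  also have "\<dots> \<in> sets steps"
    by measurable
  finally show ?thesis .
qed

lemma walk_case_nat: "walk z (case_nat e Y) (Suc k) = walk (z + e) Y k"
  by (simp add: walk_def sum.lessThan_Suc_shift add.assoc del: sum.lessThan_Suc)

lemma hit_within_Suc:
  assumes "z \<notin> A"
  shows "case_nat e Y \<in> hit_within A x (Suc n) z \<longleftrightarrow> Y \<in> hit_within A x n (z + e)"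
proof
  assume "case_nat e Y \<in> hit_within A x (Suc n) z"
  then obtain k where k: "k \<le> Suc n" "walk z (case_nat e Y) k = x" "x \<in> A"
    "\<And>m. m < k \<Longrightarrow> walk z (case_nat e Y) m \<notin> A"
    by (auto simp: hit_within_def)
  have "k \<noteq> 0"
    using k(2,3) assms by (auto simp: walk_def intro!: Nat.gr0I)
  then obtain k' where k': "k = Suc k'"
    by (cases k) auto
  have "walk (z + e) Y m \<notin> A" if "m < k'" for m
    using k(4)[of "Suc m"] that k' by (simp add: walk_case_nat)
  then show "Y \<in> hit_within A x n (z + e)"
    using k k' by (auto simp: hit_within_def walk_case_nat)
next
  assume "Y \<in> hit_within A x n (z + e)"
  then obtain k where k: "k \<le> n" "walk (z + e) Y k = x" "x \<in> A"
    "\<And>m. m < k \<Longrightarrow> walk (z + e) Y m \<notin> A"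
    by (auto simp: hit_within_def)
  have "walk z (case_nat e Y) m \<notin> A" if "m < Suc k" for m
  proof (cases m)
    case 0
    then show ?thesis using assms by (simp add: walk_def)
  next
    case (Suc m')
    then show ?thesis using k(4)[of m'] that by (simp add: walk_case_nat)
  qed
  then show "case_nat e Y \<in> hit_within A x (Suc n) z"
    using k by (auto simp: hit_within_def walk_case_nat intro!: exI[of _ "Suc k"])
qed

text \<open>Markov property at time 1: by \<open>PiM_iter\<close>, prepending an independent step to
  an i.i.d. sequence reproduces its law, and the product measure is integrated over that
  step.\<close>

lemma emeasure_hit_within_Suc:
  assumes "z \<notin> A"
  shows "emeasure steps (hit_within A x (Suc n) z) =
    (\<integral>\<^sup>+e. emeasure steps (hit_within A x n (z + e)) \<partial>measure_pmf step_pmf)"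
proof -
  interpret product_prob_space "\<lambda>_::nat. measure_pmf step_pmf" UNIV ..
  interpret sequence_space "measure_pmf step_pmf" ..
  let ?M = "measure_pmf step_pmf"
  let ?f = "\<lambda>(s, \<omega>). case_nat s \<omega> :: nat \<Rightarrow> point"
  let ?E = "hit_within A x (Suc n) z"
  have S: "steps = S"
    by (simp add: steps_def)
  have E: "?E \<in> sets S"
    using hit_within_sets S by metis
  have meas: "?f \<in> measurable (?M \<Otimes>\<^sub>M S) S"
    by measurable
  have "emeasure S ?E = emeasure (distr (?M \<Otimes>\<^sub>M S) S ?f) ?E"
    by (simp add: PiM_iter)
  also have "\<dots> = emeasure (?M \<Otimes>\<^sub>M S) (?f -` ?E \<inter> space (?M \<Otimes>\<^sub>M S))"
    by (rule emeasure_distr[OF meas E])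
  also have "\<dots> = (\<integral>\<^sup>+e. emeasure S (Pair e -` (?f -` ?E \<inter> space (?M \<Otimes>\<^sub>M S))) \<partial>?M)"
    by (rule emeasure_pair_measure_alt) (rule measurable_sets[OF meas E])
  also have "\<dots> = (\<integral>\<^sup>+e. emeasure S (hit_within A x n (z + e)) \<partial>?M)"
  proof (rule nn_integral_cong)
    fix e
    have "Pair e -` (?f -` ?E \<inter> space (?M \<Otimes>\<^sub>M S)) = hit_within A x n (z + e)"
      by (auto simp: space_pair_measure space_PiM hit_within_Suc[OF assms])
    then show "emeasure S (Pair e -` (?f -` ?E \<inter> space (?M \<Otimes>\<^sub>M S))) =
        emeasure S (hit_within A x n (z + e))"
      by simp
  qed
  finally show ?thesis
    by (simp add: S)
qed

lemma nn_integral_step_pmf: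
  assumes "\<And>e. 0 \<le> f (z + e)"
  shows "(\<integral>\<^sup>+e. ennreal (f (z + e)) \<partial>measure_pmf step_pmf) = ennreal (nbr_sum f z / 4)"
proof -
  let ?D = "{(1, 0), (-1, 0), (0, 1), (0, -1)} :: point set"
  have "(\<integral>\<^sup>+e. ennreal (f (z + e)) \<partial>measure_pmf step_pmf) =
      (\<Sum>e\<in>?D. ennreal (f (z + e))) / of_nat (card ?D)"
    unfolding step_pmf_def by (rule nn_integral_pmf_of_set) auto
  also have "(\<Sum>e\<in>?D. ennreal (f (z + e))) = ennreal (nbr_sum f z)"
    using assms by (subst sum_ennreal) (auto simp: nbr_sum_def)
  also have "of_nat (card ?D) = ennreal 4"
    by simp
  also have "ennreal (nbr_sum f z) / ennreal 4 = ennreal (nbr_sum f z / 4)"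
    using assms by (intro divide_ennreal) (simp_all add: nbr_sum_def)
  finally show ?thesis .
qed

lemma emeasure_hit_within_le:
  assumes nonneg: "\<And>z. z \<in> U \<Longrightarrow> 0 \<le> F z" and pos: "0 < F x"
    and super: "\<And>z. z \<in> U \<Longrightarrow> z \<notin> A \<Longrightarrow> nbr_sum F z \<le> 4 * F z"
    and step: "\<And>z u. z \<in> U \<Longrightarrow> z \<notin> A \<Longrightarrow> adjacent z u \<Longrightarrow> u \<in> U"
    and "z \<in> U"
  shows "emeasure steps (hit_within A x n z) \<le> ennreal (F z / F x)"
  using \<open>z \<in> U\<close>
proof (induction n arbitrary: z)
  case 0
  show ?case
  proof (cases "z = x")
    case True
    then show ?thesis
      using pos prob_space.emeasure_le_1[OF prob_space_steps] by simp
  next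
    case False
    then show ?thesis by (simp add: hit_within_def walk_def)
  qed
next
  case (Suc n)
  show ?case
  proof (cases "z \<in> A")
    case True
    show ?thesis
    proof (cases "z = x")
      case True
      then show ?thesis
        using pos prob_space.emeasure_le_1[OF prob_space_steps] by simp
    next
      case False
      have "hit_within A x (Suc n) z = {}"
      proof (rule ccontr)
        assume "hit_within A x (Suc n) z \<noteq> {}"
        then obtain X k where X: "walk z X k = x" "\<And>m. m < k \<Longrightarrow> walk z X m \<notin> A"
          by (auto simp: hit_within_def)
        have "k \<noteq> 0"
          using X(1) False by (auto simp: walk_def intro!: Nat.gr0I)
        then show False
          using X(2)[of 0] \<open>z \<in> A\<close> by (simp add: walk_def)
      qed
      then show ?thesis by simp
    qed
  next
    case False
    let ?D = "{(1, 0), (-1, 0), (0, 1), (0, -1)} :: point set"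
    have nb: "z + e \<in> U" if "e \<in> ?D" for e
      using that by (intro step[OF Suc.prems False]) (auto simp: adjacent_def)
    \<comment> \<open>\<open>F\<close> is controlled on \<open>U\<close> only, while
      \<open>nn_integral_step_pmf\<close> wants nonnegativity everywhere. The neighbours of
      \<open>z\<close> lie in \<open>U\<close>, so the cutoff leaves their values unchanged.\<close>
    define f where "f = (\<lambda>u. if u \<in> U then F u / F x else 0)"
    have f: "0 \<le> f u" for u
      using nonneg pos by (simp add: f_def)
    have "emeasure steps (hit_within A x (Suc n) z) =
        (\<integral>\<^sup>+e. emeasure steps (hit_within A x n (z + e)) \<partial>measure_pmf step_pmf)"
      by (rule emeasure_hit_within_Suc[OF False])
    also have "\<dots> \<le> (\<integral>\<^sup>+e. ennreal (f (z + e)) \<partial>measure_pmf step_pmf)"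
    proof (rule nn_integral_mono_AE, rule AE_pmfI)
      fix e assume "e \<in> set_pmf step_pmf"
      then have "z + e \<in> U"
        by (intro nb) (simp add: step_pmf_def)
      then show "emeasure steps (hit_within A x n (z + e)) \<le> ennreal (f (z + e))"
        using Suc.IH by (simp add: f_def)
    qed
    also have "\<dots> = ennreal (nbr_sum f z / 4)"
      by (rule nn_integral_step_pmf) (rule f)
    also have "\<dots> \<le> ennreal (F z / F x)"
    proof (rule ennreal_leI)
      have "nbr_sum f z = nbr_sum F z / F x"
        using nb by (simp add: nbr_sum_def f_def add_divide_distrib)
      also have "\<dots> \<le> 4 * F z / F x"
        using super[OF Suc.prems False] pos by (simp add: divide_right_mono)
      also have "\<dots> = 4 * (F z / F x)"
        by simp
      finally show "nbr_sum f z / 4 \<le> F z / F x" by linarith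
    qed
    finally show ?thesis .
  qed
qed

lemma walk_vimage_stopped_at: "walk z -` stopped_at A x = (\<Union>n. hit_within A x n z)"
proof (intro set_eqI iffI)
  fix X assume "X \<in> walk z -` stopped_at A x"
  then have ex: "\<exists>n. walk z X n \<in> A" and *: "walk z X (hitting_time A (walk z X)) = x"
    by (auto simp: stopped_at_def)
  have "walk z X (hitting_time A (walk z X)) \<in> A"
    unfolding hitting_time_def using ex by (rule LeastI_ex)
  moreover have "walk z X m \<notin> A" if "m < hitting_time A (walk z X)" for m
    using that unfolding hitting_time_def by (rule not_less_Least)
  ultimately show "X \<in> (\<Union>n. hit_within A x n z)"
    using * by (auto simp: hit_within_def intro!: exI[of _ "hitting_time A (walk z X)"])
next
  fix X assume "X \<in> (\<Union>n. hit_within A x n z)"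
  then obtain k where k: "walk z X k = x" "x \<in> A" "\<And>m. m < k \<Longrightarrow> walk z X m \<notin> A"
    by (auto simp: hit_within_def)
  then have "hitting_time A (walk z X) = k"
    unfolding hitting_time_def by (intro Least_equality) (auto simp: not_less[symmetric])
  then show "X \<in> walk z -` stopped_at A x"
    using k by (auto simp: stopped_at_def)
qed

text \<open>A nonnegative function that is superharmonic off \<open>A\<close> is a supermartingale along the
  stopped walk, whence \<open>F x \<cdot> P\<^sub>z(S\<^sub>\<tau> = x) \<le> E\<^sub>z F(S\<^sub>\<tau>) \<le> F z\<close>.\<close>

lemma emeasure_stopped_at_le:
  assumes "\<And>z. z \<in> U \<Longrightarrow> 0 \<le> F z" and "0 < F x"
    and "\<And>z. z \<in> U \<Longrightarrow> z \<notin> A \<Longrightarrow> nbr_sum F z \<le> 4 * F z"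
    and "\<And>z u. z \<in> U \<Longrightarrow> z \<notin> A \<Longrightarrow> adjacent z u \<Longrightarrow> u \<in> U"
    and "z \<in> U"
  shows "emeasure (srw z) (stopped_at A x) \<le> ennreal (F z / F x)"
proof -
  have "emeasure (srw z) (stopped_at A x) = emeasure steps (walk z -` stopped_at A x \<inter> space steps)"
    unfolding srw_def using stopped_at_sets[of A x z]
    by (intro emeasure_distr walk_measurable) (simp add: srw_def)
  also have "\<dots> = emeasure steps (\<Union>n. hit_within A x n z)"
    by (simp add: walk_vimage_stopped_at)
  also have "\<dots> = (SUP n. emeasure steps (hit_within A x n z))"
  proof (rule SUP_emeasure_incseq[symmetric])
    show "range (\<lambda>n. hit_within A x n z) \<subseteq> sets steps"
      by auto
    show "incseq (\<lambda>n. hit_within A x n z)"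
      unfolding incseq_def hit_within_def using order_trans by blast
  qed
  also have "\<dots> \<le> ennreal (F z / F x)"
    by (rule SUP_least) (rule emeasure_hit_within_le[OF assms])
  finally show ?thesis .
qed

text \<open>Sums \<open>emeasure_stopped_at_le\<close> over \<open>L N\<close>. Finite sets
  \<open>T\<close> suffice because an infinite sum in \<open>ennreal\<close> is the supremum of its
  finite subsums.\<close>

lemma H_le:
  assumes "\<And>z. z \<in> U \<Longrightarrow> 0 \<le> F z" and "0 < F x"
    and "\<And>z. z \<in> U \<Longrightarrow> z \<notin> B \<union> L 0 \<Longrightarrow> nbr_sum F z \<le> 4 * F z"
    and "\<And>z u. z \<in> U \<Longrightarrow> z \<notin> B \<union> L 0 \<Longrightarrow> adjacent z u \<Longrightarrow> u \<in> U"
    and "L N \<subseteq> U"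
    and sum: "\<And>T. finite T \<Longrightarrow> T \<subseteq> L N \<Longrightarrow> (\<Sum>z\<in>T. F z) \<le> K * F x"
  shows "H B N x \<le> ennreal K"
proof -
  have "H B N x = (SUP T\<in>{T. finite T \<and> T \<subseteq> L N - B}.
      \<Sum>z\<in>T. emeasure (srw z) (stopped_at (B \<union> L 0) x))"
    unfolding H_def by (rule nonneg_infsum_complete) simp
  also have "\<dots> \<le> ennreal K"
  proof (rule SUP_least)
    fix T assume T: "T \<in> {T. finite T \<and> T \<subseteq> L N - B}"
    have "(\<Sum>z\<in>T. emeasure (srw z) (stopped_at (B \<union> L 0) x)) \<le> (\<Sum>z\<in>T. ennreal (F z / F x))"
    proof (rule sum_mono)
      fix z assume "z \<in> T"
      then have "z \<in> U"
        using T \<open>L N \<subseteq> U\<close> by auto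
      with assms(1-4) show "emeasure (srw z) (stopped_at (B \<union> L 0) x) \<le> ennreal (F z / F x)"
        by (rule emeasure_stopped_at_le)
    qed
    also have "\<dots> = ennreal ((\<Sum>z\<in>T. F z) / F x)"
    proof -
      have "0 \<le> F z / F x" if "z \<in> T" for z
        using that T assms(1)[of z] \<open>0 < F x\<close> \<open>L N \<subseteq> U\<close> by auto
      then show ?thesis
        by (simp add: sum_divide_distrib)
    qed
    also have "\<dots> \<le> ennreal K"
      using sum[of T] T assms(2) by (intro ennreal_leI) (auto simp: divide_le_eq)
    finally show "(\<Sum>z\<in>T. emeasure (srw z) (stopped_at (B \<union> L 0) x)) \<le> ennreal K" .
  qed
  finally show ?thesis .
qed

subsection \<open>Logarithmic potentials on the half-line\<close>

text \<open>The substitution \<open>v = u^2\<close>, \<open>r = \<rho>^2\<close> turns the potential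
  integrand ln |v - r| / (2 v^(3/2)) into ln |u^2 - r| / u^2; this is an elementary antiderivative
  of the latter.\<close>

definition log_primitive :: "real \<Rightarrow> real \<Rightarrow> real" where
  "log_primitive \<rho> u = ((u - \<rho>) * ln \<bar>u - \<rho>\<bar> - (u + \<rho>) * ln (u + \<rho>)) / (u * \<rho>)"

lemma log_primitive_deriv:
  assumes "0 < \<rho>" "0 < u" "u \<noteq> \<rho>"
  shows "(log_primitive \<rho> has_real_derivative ln \<bar>u\<^sup>2 - \<rho>\<^sup>2\<bar> / u\<^sup>2) (at u)"
proof -
  have abs_deriv: "((\<lambda>u. ln \<bar>u - \<rho>\<bar>) has_real_derivative 1 / (u - \<rho>)) (at u)"
  proof (cases "u > \<rho>")
    case True
    have "((\<lambda>u. ln (u - \<rho>)) has_real_derivative 1 / (u - \<rho>)) (at u)"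
      using True by (auto intro!: derivative_eq_intros)
    then show ?thesis
      by (rule has_field_derivative_transform_within_open[where S = "{\<rho><..}"]) (use True in auto)
  next
    case False
    then have "u < \<rho>" using assms by simp
    have "((\<lambda>u. ln (\<rho> - u)) has_real_derivative 1 / (u - \<rho>)) (at u)"
      using \<open>u < \<rho>\<close> by (auto intro!: derivative_eq_intros simp: field_simps)
    then show ?thesis
      by (rule has_field_derivative_transform_within_open[where S = "{..<\<rho>}"]) (use \<open>u < \<rho>\<close> in auto)
  qed
  have l: "ln \<bar>u\<^sup>2 - \<rho>\<^sup>2\<bar> = ln \<bar>u - \<rho>\<bar> + ln (u + \<rho>)"
  proof -
    have "\<bar>u\<^sup>2 - \<rho>\<^sup>2\<bar> = \<bar>u - \<rho>\<bar> * (u + \<rho>)"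
      using assms by (simp add: power2_eq_square square_diff_square_factored abs_mult)
    then show ?thesis using assms by (simp add: ln_mult)
  qed
  have "((\<lambda>u. (u - \<rho>) * ln \<bar>u - \<rho>\<bar> - (u + \<rho>) * ln (u + \<rho>)) has_real_derivative
      (ln \<bar>u - \<rho>\<bar> - ln (u + \<rho>))) (at u)"
  proof -
    have "((\<lambda>u. (u - \<rho>) * ln \<bar>u - \<rho>\<bar>) has_real_derivative
        1 * ln \<bar>u - \<rho>\<bar> + 1 / (u - \<rho>) * (u - \<rho>)) (at u)"
      by (intro DERIV_mult abs_deriv) (auto intro!: derivative_eq_intros)
    moreover have "((\<lambda>u. (u + \<rho>) * ln (u + \<rho>)) has_real_derivative ln (u + \<rho>) + 1) (at u)"
      using assms by (auto intro!: derivative_eq_intros)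
    ultimately show ?thesis
      using assms by (auto dest: DERIV_diff)
  qed
  then have "((\<lambda>u. ((u - \<rho>) * ln \<bar>u - \<rho>\<bar> - (u + \<rho>) * ln (u + \<rho>)) / (u * \<rho>)) has_real_derivative
      ((ln \<bar>u - \<rho>\<bar> - ln (u + \<rho>)) * (u * \<rho>) -
       ((u - \<rho>) * ln \<bar>u - \<rho>\<bar> - (u + \<rho>) * ln (u + \<rho>)) * \<rho>) / ((u * \<rho>) * (u * \<rho>))) (at u)"
    using assms by (intro DERIV_divide) (auto intro!: derivative_eq_intros)
  moreover have "((ln \<bar>u - \<rho>\<bar> - ln (u + \<rho>)) * (u * \<rho>) -
       ((u - \<rho>) * ln \<bar>u - \<rho>\<bar> - (u + \<rho>) * ln (u + \<rho>)) * \<rho>) / ((u * \<rho>) * (u * \<rho>))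
     = ln \<bar>u\<^sup>2 - \<rho>\<^sup>2\<bar> / u\<^sup>2"
  proof -
    have "(ln \<bar>u - \<rho>\<bar> - ln (u + \<rho>)) * (u * \<rho>) -
       ((u - \<rho>) * ln \<bar>u - \<rho>\<bar> - (u + \<rho>) * ln (u + \<rho>)) * \<rho> =
       (\<rho> * \<rho>) * ln \<bar>u\<^sup>2 - \<rho>\<^sup>2\<bar>"
      unfolding l by (simp add: algebra_simps)
    then show ?thesis using assms by (simp add: power2_eq_square)
  qed
  ultimately show ?thesis
    by (simp add: log_primitive_def[abs_def])
qed

text \<open>Carries \<open>log_primitive\<close> across \<open>u = \<rho>\<close>, where its
  derivative blows up: t ln |t| tends to 0, which is also its value at 0.\<close>

lemma continuous_mult_ln_abs: "continuous_on UNIV (\<lambda>t::real. t * ln \<bar>t\<bar>)"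
proof (rule continuous_at_imp_continuous_on, rule ballI)
  fix t :: real
  show "isCont (\<lambda>t. t * ln \<bar>t\<bar>) t"
  proof (cases "t = 0")
    case True
    have "((\<lambda>t::real. t * ln \<bar>t\<bar>) \<longlongrightarrow> 0) (at 0)"
    proof (rule Lim_null_comparison)
      have "norm (t * ln \<bar>t\<bar>) \<le> 2 * sqrt \<bar>t\<bar>" if "t \<noteq> 0" "\<bar>t\<bar> < 1" for t :: real
      proof -
        let ?s = "sqrt \<bar>t\<bar>"
        have s: "0 < ?s" "\<bar>t\<bar> = ?s * ?s" using that by auto
        have "ln (1 / ?s) \<le> 1 / ?s - 1" using s by (intro ln_le_minus_one) simp
        then have "- ln \<bar>t\<bar> \<le> 2 / ?s"
          using s(1) that by (simp add: ln_div ln_sqrt)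
        moreover have "ln \<bar>t\<bar> \<le> 0" using that by simp
        ultimately have "\<bar>ln \<bar>t\<bar>\<bar> \<le> 2 / ?s" by linarith
        then have "\<bar>t\<bar> * \<bar>ln \<bar>t\<bar>\<bar> \<le> ?s * ?s * (2 / ?s)"
          using s by (metis abs_ge_zero mult_left_mono)
        also have "?s * ?s * (2 / ?s) = 2 * ?s"
          using s(1) by (simp only: mult.assoc times_divide_eq_right) simp
        finally show ?thesis by (simp add: abs_mult)
      qed
      then show "\<forall>\<^sub>F t::real in at 0. norm (t * ln \<bar>t\<bar>) \<le> 2 * sqrt \<bar>t\<bar>"
        by (auto simp: eventually_at intro!: exI[of _ 1])
      show "((\<lambda>t::real. 2 * sqrt \<bar>t\<bar>) \<longlongrightarrow> 0) (at 0)"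
        by (auto intro!: tendsto_eq_intros)
    qed
    then show ?thesis using True by (simp add: isCont_def)
  next
    case False
    then show ?thesis by (intro continuous_intros) auto
  qed
qed

lemma log_primitive_diff_le:
  assumes "0 < \<rho>" "0 < a" "a \<le> b" "0 < c"
    and bound: "\<And>u. a \<le> u \<Longrightarrow> u \<le> b \<Longrightarrow> \<bar>u\<^sup>2 - \<rho>\<^sup>2\<bar> \<le> c"
  shows "log_primitive \<rho> b - log_primitive \<rho> a \<le> ln c * (1 / a - 1 / b)"
proof -
  \<comment> \<open>Away from \<open>\<rho>\<close> the derivative of \<open>g\<close> is (ln |u^2 -
    \<rho>^2| - ln c) / u^2, hence nonpositive. If \<open>\<rho>\<close> is interior, continuity
    joins the two decreasing pieces.\<close>
  define g where "g u = log_primitive \<rho> u + ln c / u" for u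
  have cont: "continuous_on {0<..} g"
  proof -
    have "continuous_on {0<..} (\<lambda>u::real. (u - \<rho>) * ln \<bar>u - \<rho>\<bar>)"
      by (rule continuous_on_compose2[OF continuous_mult_ln_abs]) (auto intro!: continuous_intros)
    moreover have "continuous_on {0<..} (\<lambda>u::real. (u + \<rho>) * ln (u + \<rho>))"
      using assms(1) by (intro continuous_intros) auto
    ultimately show ?thesis
      unfolding g_def[abs_def] log_primitive_def using assms(1)
      by (intro continuous_on_add continuous_on_divide continuous_on_diff)
        (auto intro!: continuous_intros)
  qed
  have mono: "g t \<le> g s" if st: "a \<le> s" "s \<le> t" "t \<le> b" and "\<rho> \<le> s \<or> t \<le> \<rho>" for s t
  proof (rule DERIV_nonpos_imp_decreasing_open[OF \<open>s \<le> t\<close>])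
    fix u assume u: "s < u" "u < t"
    have "(g has_real_derivative ln \<bar>u\<^sup>2 - \<rho>\<^sup>2\<bar> / u\<^sup>2 - ln c / u\<^sup>2) (at u)"
      unfolding g_def[abs_def] using assms u st that
      by (auto intro!: derivative_eq_intros log_primitive_deriv simp: power2_eq_square)
    moreover have "ln \<bar>u\<^sup>2 - \<rho>\<^sup>2\<bar> \<le> ln c"
    proof -
      have "u\<^sup>2 \<noteq> \<rho>\<^sup>2"
        using assms u st that by (auto simp: power2_eq_iff_nonneg)
      then show ?thesis using bound[of u] u st by (intro ln_mono) auto
    qed
    then have "ln \<bar>u\<^sup>2 - \<rho>\<^sup>2\<bar> / u\<^sup>2 - ln c / u\<^sup>2 \<le> 0"
      by (simp add: divide_right_mono)
    ultimately show "\<exists>y. (g has_real_derivative y) (at u) \<and> y \<le> 0" by blast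
  next
    show "continuous_on {s..t} g"
      by (rule continuous_on_subset[OF cont]) (use assms st in auto)
  qed
  have "g b \<le> g a"
  proof (cases "a < \<rho> \<and> \<rho> < b")
    case True
    then show ?thesis using mono[of a \<rho>] mono[of \<rho> b] by simp
  next
    case False
    then show ?thesis using mono[of a b] assms(3) by auto
  qed
  then show ?thesis by (simp add: g_def algebra_simps)
qed

text \<open>The mass that the density 1 / (2 v^(3/2)) gives to the cell from \<open>j\<close> to
  \<open>j + 1\<close>. Since \<open>1 / 0 = 0\<close>, \<open>weight 0\<close> is -1, so indices
  start at 1 below.\<close>

definition weight :: "nat \<Rightarrow> real" where
  "weight j = 1 / sqrt j - 1 / sqrt (Suc j)"

section \<open>Moments of the weights and sums of inverse powers\<close>

lemma weight_nonneg: "1 \<le> j \<Longrightarrow> 0 \<le> weight j"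
  by (simp add: weight_def frac_le)

lemma sum_weight:
  assumes "J \<le> n" shows "(\<Sum>j=J..<n. weight j) = 1 / sqrt J - 1 / sqrt n"
  using sum_Suc_diff'[OF assms, of "\<lambda>j. - (1 / sqrt j)"] by (simp add: weight_def)

lemma weight_le:
  assumes "1 \<le> j" shows "weight j \<le> 1 / (2 * real j * sqrt j)"
proof -
  have p: "0 < sqrt (real j)" "sqrt (real j) \<le> sqrt (real (Suc j))" using assms by auto
  have "(sqrt (Suc j) - sqrt j) * (sqrt (Suc j) + sqrt j) = 1"
    by (simp add: algebra_simps flip: power2_eq_square)
  then have d: "sqrt (Suc j) - sqrt j = 1 / (sqrt (Suc j) + sqrt j)"
    using p by (intro eq_divide_imp) auto
  have "weight j = (sqrt (Suc j) - sqrt j) / (sqrt j * sqrt (Suc j))"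
    using p by (simp add: weight_def field_simps)
  also have "\<dots> = 1 / ((sqrt (Suc j) + sqrt j) * (sqrt j * sqrt (Suc j)))"
    unfolding d divide_divide_eq_left ..
  also have "\<dots> \<le> 1 / ((sqrt j + sqrt j) * (sqrt j * sqrt j))"
    using p by (intro divide_left_mono mult_mono mult_pos_pos add_mono add_pos_pos) auto
  also have "\<dots> = 1 / (2 * real j * sqrt j)"
    using assms by (simp add: algebra_simps)
  finally show ?thesis .
qed

text \<open>Each term is at most \<open>1 / sqrt j\<close>. Divided by \<open>n\<close>, this first
  moment is the relative cost, of order \<open>1 / sqrt n\<close>, of moving all the mass to
  \<open>x\<close>.\<close>

lemma sum_weight_mult_le:
  assumes "1 \<le> J"
  shows "(\<Sum>j=J..<n. weight j * (real j + 1)) \<le> 2 * sqrt n"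
proof -
  have *: "(\<Sum>j=1..m. 1 / sqrt j) \<le> 2 * sqrt m" for m :: nat
  proof (induction m)
    case (Suc m)
    let ?s = "sqrt (real m)" and ?t = "sqrt (real (Suc m))"
    have p: "0 < ?t" "0 \<le> ?s" by auto
    have q: "?s * ?s = real m" "?t * ?t = real m + 1" by auto
    have "0 \<le> (?t - ?s) * (?t - ?s)" by simp
    then have "2 * ?s * ?t + 1 \<le> 2 * (?t * ?t)"
      using q by (simp add: algebra_simps del: real_sqrt_mult_self)
    then have "2 * ?s + 1 / ?t \<le> 2 * ?t"
      using p by (simp add: field_simps del: real_sqrt_mult_self)
    then show ?case
      using Suc by (simp del: of_nat_Suc)
  qed simp
  have "(\<Sum>j=J..<n. weight j * (real j + 1)) \<le> (\<Sum>j=J..<n. 1 / sqrt j)"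
  proof (rule sum_mono)
    fix j assume "j \<in> {J..<n}"
    then have j: "1 \<le> real j" using assms by auto
    have "weight j * (real j + 1) \<le> 1 / (2 * real j * sqrt j) * (2 * real j)"
      using j by (intro mult_mono weight_le) auto
    then show "weight j * (real j + 1) \<le> 1 / sqrt j" using j by simp
  qed
  also have "\<dots> \<le> (\<Sum>j=1..n. 1 / sqrt j)"
    using assms by (intro sum_mono2) auto
  also have "\<dots> \<le> 2 * sqrt n" by (rule *)
  finally show ?thesis .
qed

lemma sum_powr_three_halves_le: "(\<Sum>j=1..m. 1 / (real j * sqrt j)) \<le> 3"
proof -
  \<comment> \<open>Strengthened for the induction: each new term is at most the drop of
    \<open>2 / sqrt m\<close>.\<close>
  have "(\<Sum>j=1..m. 1 / (real j * sqrt j)) \<le> 3 - 2 / sqrt m" if "1 \<le> m" for m :: nat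
    using that
  proof (induction m rule: dec_induct)
    case (step m)
    let ?s = "sqrt (real m)" and ?t = "sqrt (real (Suc m))"
    have p: "1 \<le> ?s" "?s \<le> ?t" using step.hyps by auto
    have q: "?s * ?s = real m" "?t * ?t = real m + 1" by auto
    have d: "(?t - ?s) * (?t + ?s) = 1" 
      using q by (simp add: algebra_simps)
    have "?t - ?s = 1 / (?t + ?s)"
      using d p by (intro eq_divide_imp) auto
    moreover have "2 / ?s - 2 / ?t = 2 * (?t - ?s) / (?s * ?t)"
      using p by (simp add: field_simps)
    ultimately have e: "2 / ?s - 2 / ?t = 2 * (1 / (?t + ?s)) / (?s * ?t)"
      by simp
    have pp: "0 < ?t + ?s" using p by linarith
    then have "1 / (2 * ?t) \<le> 1 / (?t + ?s)"
      using p by (intro divide_left_mono mult_pos_pos) auto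
    have "1 / (real (Suc m) * ?t) = 2 * (1 / (2 * ?t)) / (?t * ?t)"
      by (simp add: mult.commute)
    also have "\<dots> \<le> 2 * (1 / (?t + ?s)) / (?s * ?t)"
      using p pp \<open>1 / (2 * ?t) \<le> 1 / (?t + ?s)\<close> by (intro frac_le mult_mono) auto
    also have "\<dots> = 2 / ?s - 2 / ?t" by (rule e[symmetric])
    finally have "1 / (real (Suc m) * ?t) \<le> 2 / ?s - 2 / ?t" .
    then show ?case
      using step by simp
  qed simp
  then show ?thesis
    using zero_le_divide_iff by (cases "m = 0") (fastforce, smt (verit) divide_nonneg_nonneg less_one not_le of_nat_0_le_iff real_sqrt_ge_zero)
qed

text \<open>For \<open>s = (J / r)\<^sup>1\<^sup>/\<^sup>2\<close>, the value at \<open>r\<close> of the logarithmic potential of the probability density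
  \<open>J\<^sup>1\<^sup>/\<^sup>2 / (2 v\<^sup>3\<^sup>/\<^sup>2)\<close> on \<open>{J..}\<close> is \<open>ln r + slack s\<close>. The slack, at least \<open>J / r\<close> when \<open>r > J\<close>,
  pays for the \<open>O(J\<^sup>1\<^sup>/\<^sup>2 / r)\<close> lost by discretizing.\<close>

definition slack :: "real \<Rightarrow> real" where
  "slack s = (1 + s) * ln (1 + s) - (s - 1) * ln \<bar>s - 1\<bar>"

text \<open>Scaling by \<open>u = s * \<rho>\<close>: the coefficients of \<open>ln \<rho>\<close>
  combine to (s - 1) - (s + 1) = -2.\<close>

lemma log_primitive_eq_slack:
  assumes "0 < \<rho>" "0 < u"
  shows "u * log_primitive \<rho> u = - (2 * ln \<rho> + slack (u / \<rho>))"
proof -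
  define s where "s = u / \<rho>"
  have s: "0 < s" "u = s * \<rho>" using assms by (simp_all add: s_def)
  have a: "ln (s * \<rho> + \<rho>) = ln (1 + s) + ln \<rho>"
  proof -
    have "s * \<rho> + \<rho> = (1 + s) * \<rho>" by (simp add: algebra_simps)
    then show ?thesis using s assms by (simp add: ln_mult)
  qed
  have b: "(s - 1) * ln \<bar>s * \<rho> - \<rho>\<bar> = (s - 1) * (ln \<bar>s - 1\<bar> + ln \<rho>)"
  proof (cases "s = 1")
    case False
    have "s * \<rho> - \<rho> = (s - 1) * \<rho>" by (simp add: algebra_simps)
    then have "\<bar>s * \<rho> - \<rho>\<bar> = \<bar>s - 1\<bar> * \<rho>" using assms by (simp add: abs_mult)
    then show ?thesis using False assms by (simp add: ln_mult)
  qed simp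
  have "u * log_primitive \<rho> u = (s * \<rho> - \<rho>) * ln \<bar>s * \<rho> - \<rho>\<bar> / \<rho> - (s * \<rho> + \<rho>) * ln (s * \<rho> + \<rho>) / \<rho>"
    using s(1) assms by (simp add: log_primitive_def s(2) field_simps)
  also have "\<dots> = (s - 1) * ln \<bar>s * \<rho> - \<rho>\<bar> - (1 + s) * ln (s * \<rho> + \<rho>)"
    using assms by (simp add: field_simps)
  also have "\<dots> = - (2 * ln \<rho> + slack s)"
    unfolding a b slack_def by (simp add: algebra_simps)
  finally show ?thesis by (simp add: s_def)
qed

lemma slack_eq: "1 < s \<Longrightarrow> slack s = 2 * ln (1 + s) + (s - 1) * (ln (1 + s) - ln (s - 1))"
  by (simp add: slack_def algebra_simps)

lemma slack_ge_2_ln_2: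
  assumes "1 \<le> s" shows "2 * ln 2 \<le> slack s"
proof (cases "s = 1")
  case True
  then show ?thesis by (simp add: slack_def)
next
  case False
  then have s: "1 < s" using assms by simp
  have "ln 2 \<le> ln (1 + s)" "ln (s - 1) \<le> ln (1 + s)" using s by auto
  then show ?thesis using s by (simp add: slack_eq add_increasing2)
qed

text \<open>Used at the truncation point with \<open>s = sqrt n / sqrt r\<close>, where
  \<open>1 / 2 \<le> s\<close> means \<open>r \<le> 4 * n\<close>.\<close>

lemma slack_le:
  assumes "1 / 2 \<le> s" shows "slack s \<le> 2 * ln s + 5"
proof -
  have l2: "ln 2 \<le> (1 :: real)" using ln_le_minus_one[of "2 :: real"] by simp
  consider "1 < s" | "s = 1" | "s < 1" by linarith
  then show ?thesis
  proof cases
    case 1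
    have "ln (1 + s) \<le> ln (2 * s)" using 1 by simp
    also have "\<dots> = ln 2 + ln s" using 1 by (simp add: ln_mult)
    finally have a: "ln (1 + s) \<le> 1 + ln s" using l2 by simp
    have "ln (1 + s) - ln (s - 1) = ln ((1 + s) / (s - 1))" using 1 by (simp add: ln_div)
    also have "\<dots> \<le> (1 + s) / (s - 1) - 1" using 1 by (intro ln_le_minus_one) simp
    also have "\<dots> = 2 / (s - 1)" using 1 by (simp add: field_simps)
    finally have "(s - 1) * (ln (1 + s) - ln (s - 1)) \<le> (s - 1) * (2 / (s - 1))"
      using 1 by (intro mult_left_mono) auto
    also have "(s - 1) * (2 / (s - 1)) = 2"
      using 1 by (simp only: times_divide_eq_right) (simp only: nonzero_mult_div_cancel_left)
    finally show ?thesis using a 1 by (simp add: slack_eq)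
  next
    case 2
    then show ?thesis using l2 by (simp add: slack_def)
  next
    case 3
    have "(1 + s) * ln (1 + s) \<le> 2 * ln 2"
      using 3 assms by (intro mult_mono) auto
    moreover have "(1 - s) * ln (1 - s) \<le> 0"
      using 3 assms by (intro mult_nonneg_nonpos) auto
    ultimately have "slack s \<le> 2 * ln 2" using 3 by (simp add: slack_def algebra_simps)
    moreover have "- ln 2 \<le> ln s"
    proof -
      have "ln (1 / 2) \<le> ln s" using assms by (intro ln_mono) auto
      then show ?thesis by (simp add: ln_div)
    qed
    ultimately show ?thesis using l2 by linarith
  qed
qed

text \<open>Both sides vanish at 0, and the derivative ln (1 + t) - ln (1 - t) of the slack is at
  least 2 t, the quadratic terms of the two Taylor bounds cancelling.\<close>

lemma slack_ge_square:
  assumes "0 < s" "s < 1" shows "s\<^sup>2 \<le> slack s"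
proof -
  define f where "f t = (1 + t) * ln (1 + t) + (1 - t) * ln (1 - t) - t\<^sup>2" for t :: real
  have "f 0 \<le> f s"
  proof (rule DERIV_nonneg_imp_nondecreasing[where f = f])
    fix t assume t: "0 \<le> t" "t \<le> s"
    then have t1: "t < 1" using assms by simp
    have "(f has_real_derivative (ln (1 + t) + 1 - ln (1 - t) - 1 - 2 * t)) (at t)"
      unfolding f_def[abs_def] using t t1 by (auto intro!: derivative_eq_intros)
    moreover have "0 \<le> ln (1 + t) + 1 - ln (1 - t) - 1 - 2 * t"
    proof -
      have "ln (1 - t) \<le> - t - t\<^sup>2 / 2"
      proof -
        define g where "g u = - u - u\<^sup>2 / 2 - ln (1 - u)" for u :: real
        have "g 0 \<le> g t"
        proof (rule DERIV_nonneg_imp_nondecreasing[where f = g])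
          fix u assume u: "0 \<le> u" "u \<le> t"
          have "(g has_real_derivative (- 1 - u + 1 / (1 - u))) (at u)"
            unfolding g_def[abs_def] using u t1 by (auto intro!: derivative_eq_intros simp: field_simps)
          moreover have "0 \<le> - 1 - u + 1 / (1 - u)"
          proof -
            have "(1 + u) * (1 - u) \<le> 1" by (simp add: algebra_simps)
            then have "1 + u \<le> 1 / (1 - u)" using u t1 by (simp add: pos_le_divide_eq)
            then show ?thesis by simp
          qed
          ultimately show "\<exists>y. (g has_real_derivative y) (at u) \<and> 0 \<le> y" by blast
        qed (use t in auto)
        then show ?thesis by (simp add: g_def)
      qed
      moreover have "t - t\<^sup>2 / 2 \<le> ln (1 + t)"
      proof -
        define g where "g u = ln (1 + u) - u + u\<^sup>2 / 2" for u :: real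
        have "g 0 \<le> g t"
        proof (rule DERIV_nonneg_imp_nondecreasing[where f = g])
          fix u assume u: "0 \<le> u" "u \<le> t"
          have "(g has_real_derivative (1 / (1 + u) - 1 + u)) (at u)"
            unfolding g_def[abs_def] using u by (auto intro!: derivative_eq_intros simp: field_simps)
          moreover have "0 \<le> 1 / (1 + u) - 1 + u"
          proof -
            have "(1 - u) * (1 + u) \<le> 1" by (simp add: algebra_simps)
            then have "1 - u \<le> 1 / (1 + u)" using u by (simp add: pos_le_divide_eq)
            then show ?thesis by simp
          qed
          ultimately show "\<exists>y. (g has_real_derivative y) (at u) \<and> 0 \<le> y" by blast
        qed (use t in auto)
        then show ?thesis by (simp add: g_def)
      qed
      ultimately show ?thesis by simp
    qed
    ultimately show "\<exists>y. (f has_real_derivative y) (at t) \<and> 0 \<le> y" by blast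
  qed (use assms in auto)
  then show ?thesis using assms by (simp add: f_def slack_def algebra_simps)
qed

text \<open>Cell by cell: if v and \<open>d j\<close> both lie between \<open>j\<close> and
  \<open>j + 1\<close>, then |v - r| is at most 1 + |r - \<open>d j\<close>|, so the integral over
  the cell is below the corresponding summand.\<close>

lemma sum_weight_ln_ge:
  assumes "1 \<le> J" "J \<le> n" "0 < r"
    and d: "\<And>j. J \<le> j \<Longrightarrow> j < n \<Longrightarrow> real j \<le> d j \<and> d j < real j + 1"
  shows "log_primitive (sqrt r) (sqrt n) - log_primitive (sqrt r) (sqrt J)
    \<le> (\<Sum>j=J..<n. weight j * ln (1 + \<bar>r - d j\<bar>))"
proof -
  have "log_primitive (sqrt r) (sqrt n) - log_primitive (sqrt r) (sqrt J) =
      (\<Sum>j=J..<n. log_primitive (sqrt r) (sqrt (Suc j)) - log_primitive (sqrt r) (sqrt j))"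
    using sum_Suc_diff'[OF \<open>J \<le> n\<close>, of "\<lambda>j. log_primitive (sqrt r) (sqrt j)"] by simp
  also have "\<dots> \<le> (\<Sum>j=J..<n. weight j * ln (1 + \<bar>r - d j\<bar>))"
  proof (rule sum_mono)
    fix j assume "j \<in> {J..<n}"
    then have j: "1 \<le> j" "real j \<le> d j" "d j < real j + 1"
      using assms(1) d[of j] by auto
    have "log_primitive (sqrt r) (sqrt (Suc j)) - log_primitive (sqrt r) (sqrt j)
        \<le> ln (1 + \<bar>r - d j\<bar>) * (1 / sqrt j - 1 / sqrt (Suc j))"
    proof (rule log_primitive_diff_le)
      fix u assume u: "sqrt j \<le> u" "u \<le> sqrt (Suc j)"
      have "0 \<le> u" using u(1) by (meson order_trans real_sqrt_ge_zero of_nat_0_le_iff)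
      have "(sqrt j)\<^sup>2 \<le> u\<^sup>2" using u by (intro power_mono) auto
      moreover have "u\<^sup>2 \<le> (sqrt (Suc j))\<^sup>2" using u \<open>0 \<le> u\<close> by (intro power_mono) auto
      ultimately have "j \<le> u\<^sup>2" "u\<^sup>2 \<le> real j + 1" by auto
      then show "\<bar>u\<^sup>2 - (sqrt r)\<^sup>2\<bar> \<le> 1 + \<bar>r - d j\<bar>"
        using j \<open>0 < r\<close> by auto
    qed (use j \<open>0 < r\<close> in auto)
    then show "log_primitive (sqrt r) (sqrt (Suc j)) - log_primitive (sqrt r) (sqrt j)
        \<le> weight j * ln (1 + \<bar>r - d j\<bar>)"
      by (simp add: weight_def mult.commute)
  qed
  finally show ?thesis .
qed

text \<open>On either side of the integer part of \<open>r\<close>, the numbers 1 + |r - j| dominate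
  distinct positive integers, so \<open>sum_powr_three_halves_le\<close> applies twice.\<close>

lemma sum_inverse_three_halves_le:
  fixes r :: real
  assumes "0 \<le> r"
  shows "(\<Sum>j=1..m. 1 / ((1 + \<bar>r - real j\<bar>) * sqrt (1 + \<bar>r - real j\<bar>))) \<le> 6"
proof -
  define i where "i = nat \<lfloor>r\<rfloor>"
  have i: "real i \<le> r" "r < real i + 1" using assms by (auto simp: i_def)
  let ?g = "\<lambda>k::nat. 1 / (real k * sqrt k)"
  let ?f = "\<lambda>j::nat. 1 / ((1 + \<bar>r - real j\<bar>) * sqrt (1 + \<bar>r - real j\<bar>))"
  have le: "?f j \<le> ?g k" if "1 \<le> k" "real k \<le> 1 + \<bar>r - real j\<bar>" for j k
    using that by (intro divide_left_mono mult_mono mult_pos_pos) auto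
  have bound: "(\<Sum>k\<in>A. ?g k) \<le> 3" if "finite A" "0 \<notin> A" for A
  proof -
    have "A \<subseteq> {1..Max (insert 0 A)}"
      using that by (auto simp: Suc_le_eq intro!: Nat.gr0I)
    then have "(\<Sum>k\<in>A. ?g k) \<le> (\<Sum>k=1..Max (insert 0 A). ?g k)"
      by (intro sum_mono2) auto
    then show ?thesis using sum_powr_three_halves_le order_trans by blast
  qed
  have "(\<Sum>j=1..m. ?f j) = (\<Sum>j\<in>{1..m} \<inter> {..i}. ?f j) + (\<Sum>j\<in>{1..m} - {..i}. ?f j)"
    by (intro sum.Int_Diff) auto
  also have "(\<Sum>j\<in>{1..m} \<inter> {..i}. ?f j) \<le> (\<Sum>j\<in>{1..m} \<inter> {..i}. ?g (1 + i - j))"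
    using i by (intro sum_mono le) (auto simp: of_nat_diff)
  also have "\<dots> = (\<Sum>k\<in>(\<lambda>j. 1 + i - j) ` ({1..m} \<inter> {..i}). ?g k)"
    by (subst sum.reindex) (auto simp: inj_on_def)
  also have "\<dots> \<le> 3" by (rule bound) auto
  also have "(\<Sum>j\<in>{1..m} - {..i}. ?f j) \<le> (\<Sum>j\<in>{1..m} - {..i}. ?g (j - i))"
    using i by (intro sum_mono le) (auto simp: of_nat_diff)
  also have "\<dots> = (\<Sum>k\<in>(\<lambda>j. j - i) ` ({1..m} - {..i}). ?g k)"
    by (subst sum.reindex) (auto simp: inj_on_def)
  also have "\<dots> \<le> 3" by (rule bound) auto
  finally show ?thesis by simp
qed

text \<open>With b = 1 + |r - j|, each term is at most j^(-3/2) or b^(-3/2), according to which of j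
  and b is smaller.\<close>

lemma sum_inverse_sqrt_mult_le:
  fixes r :: real
  assumes "0 \<le> r"
  shows "(\<Sum>j=1..m. 1 / (sqrt j * (1 + \<bar>r - real j\<bar>))) \<le> 9"
proof -
  have "(\<Sum>j=1..m. 1 / (sqrt j * (1 + \<bar>r - real j\<bar>))) \<le>
    (\<Sum>j=1..m. 1 / (real j * sqrt j) + 1 / ((1 + \<bar>r - real j\<bar>) * sqrt (1 + \<bar>r - real j\<bar>)))"
  proof (rule sum_mono)
    fix j assume "j \<in> {1..m}"
    then have j: "1 \<le> real j" by auto
    define b where "b = 1 + \<bar>r - real j\<bar>"
    have b: "1 \<le> b" by (simp add: b_def)
    have "1 / (sqrt j * b) \<le> 1 / (real j * sqrt j) + 1 / (b * sqrt b)"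
    proof (cases "real j \<le> b")
      case True
      then have "1 / (sqrt j * b) \<le> 1 / (sqrt j * real j)"
        using j b by (intro divide_left_mono mult_left_mono mult_pos_pos) auto
      also have "\<dots> \<le> 1 / (real j * sqrt j) + 1 / (b * sqrt b)"
        using b by (simp add: mult.commute)
      finally show ?thesis .
    next
      case False
      then have "1 / (sqrt j * b) \<le> 1 / (sqrt b * b)"
        using j b by (intro divide_left_mono mult_right_mono mult_pos_pos) auto
      also have "\<dots> \<le> 1 / (real j * sqrt j) + 1 / (b * sqrt b)"
        using j by (simp add: mult.commute)
      finally show ?thesis .
    qed
    then show "1 / (sqrt j * (1 + \<bar>r - real j\<bar>)) \<le>
        1 / (real j * sqrt j) + 1 / ((1 + \<bar>r - real j\<bar>) * sqrt (1 + \<bar>r - real j\<bar>))"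
      by (simp add: b_def)
  qed
  also have "\<dots> \<le> 3 + 6"
    unfolding sum.distrib by (intro add_mono sum_powr_three_halves_le sum_inverse_three_halves_le assms)
  finally show ?thesis by simp
qed

text \<open>Since r is at most (1 + |r - j|) + j, each term splits into a weight, which telescopes,
  and half a term of \<open>sum_inverse_sqrt_mult_le\<close>. The error thus decays like 1 / r, the
  rate of the slack.\<close>

lemma sum_weight_error_le:
  fixes r :: real
  assumes "1 \<le> J" "0 \<le> r"
  shows "r * (\<Sum>j=J..<n. weight j / (1 + \<bar>r - real j\<bar>)) \<le> 1 / sqrt J + 9 / 2"
proof (cases "J \<le> n")
  case True
  have "r * (\<Sum>j=J..<n. weight j / (1 + \<bar>r - real j\<bar>)) =
      (\<Sum>j=J..<n. weight j * (r / (1 + \<bar>r - real j\<bar>)))"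
    by (simp add: sum_distrib_left mult_ac)
  also have "\<dots> \<le> (\<Sum>j=J..<n. weight j + 1 / (sqrt j * (1 + \<bar>r - real j\<bar>)) / 2)"
  proof (rule sum_mono)
    fix j assume "j \<in> {J..<n}"
    then have j: "1 \<le> j" using assms by auto
    define b where "b = 1 + \<bar>r - real j\<bar>"
    have b: "1 \<le> b" "r \<le> b + j" by (auto simp: b_def)
    have "r / b \<le> 1 + j / b" using b by (simp add: field_simps)
    then have "weight j * (r / b) \<le> weight j * (1 + j / b)"
      using j by (intro mult_left_mono weight_nonneg) auto
    also have "\<dots> = weight j + weight j * (j / b)" by (simp add: algebra_simps)
    also have "weight j * (j / b) \<le> 1 / (2 * real j * sqrt j) * (j / b)"
      using j b by (intro mult_right_mono weight_le) auto
    also have "\<dots> = 1 / (sqrt j * b) / 2" using j by simp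
    finally show "weight j * (r / (1 + \<bar>r - real j\<bar>)) \<le>
        weight j + 1 / (sqrt j * (1 + \<bar>r - real j\<bar>)) / 2"
      by (simp add: b_def)
  qed
  also have "\<dots> = (\<Sum>j=J..<n. weight j) + (\<Sum>j=J..<n. 1 / (sqrt j * (1 + \<bar>r - real j\<bar>))) / 2"
    by (simp add: sum.distrib sum_divide_distrib)
  also have "(\<Sum>j=J..<n. 1 / (sqrt j * (1 + \<bar>r - real j\<bar>))) \<le>
      (\<Sum>j=1..n. 1 / (sqrt j * (1 + \<bar>r - real j\<bar>)))"
    using assms by (intro sum_mono2) auto
  also have "\<dots> \<le> 9" by (rule sum_inverse_sqrt_mult_le[OF assms(2)])
  also have "(\<Sum>j=J..<n. weight j) \<le> 1 / sqrt J"
    by (simp add: sum_weight[OF True])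
  finally show ?thesis by simp
next
  case False
  then show ?thesis by simp
qed

text \<open>The slack pays for everything: the fractions with 11 cover replacing ln by
  \<open>log_super\<close>, the term \<open>1 / (4 * r\<^sup>2)\<close> covers replacing
  \<open>ln r\<close> by \<open>log_sub\<close>, and the term in \<open>1 / sqrt n\<close> is the
  truncation loss.\<close>

lemma sum_weight_ln_minus_error_ge:
  assumes "3600 \<le> n" "1 \<le> r" "r \<le> 4 * real n"
    and d: "\<And>j. 3600 \<le> j \<Longrightarrow> j < n \<Longrightarrow> real j \<le> d j \<and> d j < real j + 1"
  shows "ln r + 1 / (4 * r\<^sup>2) - 60 / sqrt n * (ln n + 5) \<le>
    60 * (\<Sum>j=3600..<n. weight j * (ln (1 + \<bar>r - d j\<bar>) - 11 / (1 + \<bar>r - real j\<bar>)))"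
proof -
  define E where "E r = (\<Sum>j=3600..<n. weight j / (1 + \<bar>r - real j\<bar>))" for r :: real
  have sq: "sqrt 3600 = 60" by (rule real_sqrt_unique) auto
  have E: "r * E r \<le> 1 / 60 + 9 / 2" if "0 \<le> r" for r
    using sum_weight_error_le[of 3600 r n] that by (simp add: E_def sq)
  have lnr: "2 * ln (sqrt r) = ln r" using assms by (simp add: ln_sqrt)
  have sl: "660 * E r + 1 / (4 * r\<^sup>2) \<le> slack (60 / sqrt r)"
  \<comment> \<open>Beyond 3600 the slack is at least 3600 / r, against errors 660 (1/60 + 9/2) / r
    = 2981 / r and at most 1 / r. Below, \<open>E\<close> is largest at 3600 and the slack is at
    least 2 ln 2.\<close>
  proof (cases "r > 3600")
    case True
    have "60 < sqrt r" using True by (metis real_sqrt_less_iff sq)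
    have "(60 / sqrt r)\<^sup>2 \<le> slack (60 / sqrt r)"
      using \<open>60 < sqrt r\<close> True by (intro slack_ge_square) (auto simp: divide_less_eq)
    moreover have "(60 / sqrt r)\<^sup>2 = 3600 / r"
      using True by (simp add: power_divide)
    moreover have "660 * E r \<le> 2981 / r"
      using E[of r] True by (simp add: field_simps)
    moreover have "1 / (4 * r\<^sup>2) \<le> 1 / r"
      using True by (simp add: power2_eq_square field_simps)
    moreover have "3600 / r - 2981 / r - 1 / r = 618 / r" by (simp add: diff_divide_distrib)
    moreover have "0 \<le> 618 / r" using True by simp
    ultimately show ?thesis by linarith
  next
    case False
    have "sqrt r \<le> 60" using False by (metis not_le real_sqrt_le_iff sq)
    then have "2 * ln 2 \<le> slack (60 / sqrt r)"
      using assms by (intro slack_ge_2_ln_2) simp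
    moreover have "E r \<le> E 3600"
      unfolding E_def
    proof (intro sum_mono divide_left_mono weight_nonneg)
      fix j assume j: "j \<in> {3600..<n}"
      then show "1 + \<bar>3600 - real j\<bar> \<le> 1 + \<bar>r - real j\<bar>" using False by auto
    qed (auto intro!: mult_pos_pos add_pos_nonneg)
    moreover have "3600 * E 3600 \<le> 1 / 60 + 9 / 2" using E[of 3600] by simp
    moreover have "1 / (4 * r\<^sup>2) \<le> 1 / 4"
      using assms by simp
    moreover have "(2 / 3 :: real) \<le> ln 2" using ln2_ge_two_thirds by simp
    ultimately show ?thesis by linarith
  qed
  have J: "60 * log_primitive (sqrt r) 60 = - (ln r + slack (60 / sqrt r))"
    using log_primitive_eq_slack[of "sqrt r" 60] assms lnr by simp
  have n: "- (ln n + 5) \<le> sqrt n * log_primitive (sqrt r) (sqrt n)"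
  proof -
    have s: "1 / 2 \<le> sqrt n / sqrt r"
    proof -
      have "sqrt r \<le> sqrt (4 * real n)" using assms by simp
      also have "\<dots> = 2 * sqrt n" by (simp add: real_sqrt_mult)
      finally show ?thesis using assms by (simp add: field_simps)
    qed
    have "sqrt n * log_primitive (sqrt r) (sqrt n) = - (ln r + slack (sqrt n / sqrt r))"
      using log_primitive_eq_slack[of "sqrt r" "sqrt n"] assms lnr by simp
    moreover have "2 * ln (sqrt n / sqrt r) = ln n - ln r"
      using assms lnr by (simp add: ln_div ln_sqrt)
    ultimately show ?thesis using slack_le[OF s] by linarith
  qed
  have "60 / sqrt n * - (ln n + 5) \<le> 60 / sqrt n * (sqrt n * log_primitive (sqrt r) (sqrt n))"
    using n by (intro mult_left_mono) auto
  also have "\<dots> = 60 * log_primitive (sqrt r) (sqrt n)" using assms by simp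
  finally have N: "- (60 / sqrt n * (ln n + 5)) \<le> 60 * log_primitive (sqrt r) (sqrt n)"
    by (simp only: mult_minus_right)
  have "log_primitive (sqrt r) (sqrt n) - log_primitive (sqrt r) 60 \<le>
      (\<Sum>j=3600..<n. weight j * ln (1 + \<bar>r - d j\<bar>))"
    using sum_weight_ln_ge[of 3600 n r d] assms by (simp add: sq)
  moreover have "(\<Sum>j=3600..<n. weight j * (ln (1 + \<bar>r - d j\<bar>) - 11 / (1 + \<bar>r - real j\<bar>))) =
      (\<Sum>j=3600..<n. weight j * ln (1 + \<bar>r - d j\<bar>)) - 11 * E r"
    by (simp add: E_def right_diff_distrib sum_subtractf sum_distrib_left mult_ac)
  ultimately show ?thesis using sl J N by argo
qed

subsection \<open>Approximate Green kernels of the half plane\<close>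

text \<open>The Euclidean norm, written as a complex modulus to inherit the triangle
  inequality.\<close>

definition nrm :: "point \<Rightarrow> real" where
  "nrm p = cmod (Complex (of_int (fst p)) (of_int (snd p)))"

lemma nrm_square: "(nrm p)\<^sup>2 = (of_int (fst p))\<^sup>2 + (of_int (snd p))\<^sup>2"
  by (simp add: nrm_def cmod_power2)

lemma nrm_nonneg [simp]: "0 \<le> nrm p"
  by (simp add: nrm_def)

lemma nrm_zero [simp]: "nrm 0 = 0"
  by (simp add: nrm_def complex_eq_iff)

lemma nrm_ge_1:
  assumes "p \<noteq> 0" shows "1 \<le> nrm p"
proof -
  have "1 \<le> (fst p)\<^sup>2 + (snd p)\<^sup>2"
    using assms sum_power2_gt_zero_iff[of "fst p" "snd p"] by (auto simp: prod_eq_iff)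
  then have "real_of_int 1 \<le> of_int ((fst p)\<^sup>2 + (snd p)\<^sup>2)"
    by (simp only: of_int_le_iff)
  then have "1\<^sup>2 \<le> (nrm p)\<^sup>2" by (simp add: nrm_square)
  then show ?thesis by (rule power2_le_imp_le) simp
qed

lemma nrm_triangle: "nrm (p + q) \<le> nrm p + nrm q"
proof -
  have "Complex (of_int (fst (p + q))) (of_int (snd (p + q))) =
      Complex (of_int (fst p)) (of_int (snd p)) + Complex (of_int (fst q)) (of_int (snd q))"
    by (simp add: complex_eq_iff)
  then show ?thesis unfolding nrm_def by (simp only: norm_triangle_ineq)
qed

lemma nrm_minus: "nrm (p - q) = nrm (q - p)"
proof -
  have "(nrm (p - q))\<^sup>2 = (nrm (q - p))\<^sup>2" by (simp add: nrm_square power2_commute)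
  then show ?thesis by simp
qed

lemma nrm_diff_le: "\<bar>nrm (p - q) - nrm (p' - q)\<bar> \<le> nrm (p - p')"
  using nrm_triangle[of "p - p'" "p' - q"] nrm_triangle[of "p' - p" "p - q"] nrm_minus[of p p']
  by simp

lemma snd_le_nrm: "\<bar>of_int (snd p)\<bar> \<le> nrm p"
  using abs_Im_le_cmod[of "Complex (of_int (fst p)) (of_int (snd p))"] by (simp add: nrm_def)

lemma nrm_adjacent:
  assumes "adjacent p q" shows "nrm (p - q) = 1"
proof -
  have "(fst (p - q) = 0 \<and> \<bar>snd (p - q)\<bar> = 1) \<or> (\<bar>fst (p - q)\<bar> = 1 \<and> snd (p - q) = 0)"
    using assms by (auto simp: adjacent_def)
  then have "(fst (p - q))\<^sup>2 + (snd (p - q))\<^sup>2 = 1"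
    by (auto simp: abs_square_eq_1)
  then have "of_int ((fst (p - q))\<^sup>2 + (snd (p - q))\<^sup>2) = (1 :: real)" by simp
  then have "(nrm (p - q))\<^sup>2 = 1" by (simp add: nrm_square)
  then show ?thesis using nrm_nonneg[of "p - q"] by (simp add: power2_eq_1_iff)
qed

text \<open>Up to \<open>O(|w|\<^sup>-\<^sup>2)\<close> both functions are \<open>ln |w|\<close>. The shifts by \<open>1/2\<close> are the ones for which
  the product of the four neighbouring arguments compares with the fourth power of the central one
  everywhere, and \<open>126\<close> is what superharmonicity at the neighbours of \<open>0\<close> demands.\<close>

definition log_sub :: "point \<Rightarrow> real" where
  "log_sub w = ln ((nrm w)\<^sup>2 + 1 / 2) / 2"

definition log_super :: "point \<Rightarrow> real" where
  "log_super w = ln (if w = 0 then 1 / 126 else (nrm w)\<^sup>2 - 1 / 2) / 2"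

lemma four_ln_le:
  fixes a b c d q :: real
  assumes "0 < a" "0 < b" "0 < c" "0 < d" "0 < q"
  shows "a * b * c * d \<le> q ^ 4 \<Longrightarrow> ln a + ln b + ln c + ln d \<le> 4 * ln q"
    and "q ^ 4 \<le> a * b * c * d \<Longrightarrow> 4 * ln q \<le> ln a + ln b + ln c + ln d"
proof -
  have *: "ln (a * b * c * d) = ln a + ln b + ln c + ln d" "ln (q ^ 4) = 4 * ln q"
    using assms by (simp_all add: ln_mult ln_realpow)
  have "0 < a * b * c * d" "0 < q ^ 4"
    using assms by simp_all
  then show "a * b * c * d \<le> q ^ 4 \<Longrightarrow> ln a + ln b + ln c + ln d \<le> 4 * ln q"
    and "q ^ 4 \<le> a * b * c * d \<Longrightarrow> 4 * ln q \<le> ln a + ln b + ln c + ln d"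
    using ln_mono * by metis+
qed

lemma log_sub_subharmonic: "4 * log_sub w \<le> nbr_sum log_sub w"
proof -
  define a b where "a = real_of_int (fst w)" and "b = real_of_int (snd w)"
  define q where "q e = (nrm (w + e))\<^sup>2 + 1 / 2" for e
  have q: "0 < q e" for e by (simp add: q_def add_nonneg_pos)
  have q_eq: "q 0 = a\<^sup>2 + b\<^sup>2 + 1 / 2" "q (1, 0) = (a + 1)\<^sup>2 + b\<^sup>2 + 1 / 2"
    "q (-1, 0) = (a - 1)\<^sup>2 + b\<^sup>2 + 1 / 2" "q (0, 1) = a\<^sup>2 + (b + 1)\<^sup>2 + 1 / 2"
    "q (0, -1) = a\<^sup>2 + (b - 1)\<^sup>2 + 1 / 2"
    by (simp_all add: q_def nrm_square a_def b_def)
  have "q (1, 0) * q (-1, 0) * q (0, 1) * q (0, -1) - q 0 ^ 4 =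
      4 * (a\<^sup>2 + b\<^sup>2) + 5 + 16 * (a * b)\<^sup>2"
    unfolding q_eq by algebra
  moreover have "0 \<le> 4 * (a\<^sup>2 + b\<^sup>2) + 5 + 16 * (a * b)\<^sup>2" by simp
  ultimately have "q 0 ^ 4 \<le> q (1, 0) * q (-1, 0) * q (0, 1) * q (0, -1)" by linarith
  then have "4 * ln (q 0) \<le> ln (q (1, 0)) + ln (q (-1, 0)) + ln (q (0, 1)) + ln (q (0, -1))"
    by (rule four_ln_le(2)[OF q q q q q])
  then show ?thesis by (simp add: nbr_sum_def log_sub_def q_def)
qed

lemma log_super_superharmonic:
  assumes "w \<noteq> 0" shows "nbr_sum log_super w \<le> 4 * log_super w"
proof -
  define a b where "a = real_of_int (fst w)" and "b = real_of_int (snd w)"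
  define q where "q e = (if w + e = 0 then 1 / 126 else (nrm (w + e))\<^sup>2 - 1 / 2)" for e
  have q: "0 < q e" for e
  proof -
    have "1\<^sup>2 \<le> (nrm (w + e))\<^sup>2" if "w + e \<noteq> 0"
      using nrm_ge_1[OF that] by (intro power_mono) auto
    then show ?thesis by (auto simp: q_def)
  qed
  have "q (1, 0) * q (-1, 0) * q (0, 1) * q (0, -1) \<le> q 0 ^ 4"
  proof (cases "w \<in> {(1, 0), (-1, 0), (0, 1), (0, -1)}")
    case True
    \<comment> \<open>Here the four arguments are 1/126, 7/2, 3/2 and 3/2, with product exactly
      (1/2)^4.\<close>
    then show ?thesis by (auto simp: q_def nrm_square zero_prod_def power4_eq_xxxx)
  next
    case False
    then have nz: "w + e \<noteq> 0" if "e \<in> {0, (1, 0), (-1, 0), (0, 1), (0, -1)}" for e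
      using that assms by (cases w) (auto simp: zero_prod_def)
    have q_eq: "q 0 = a\<^sup>2 + b\<^sup>2 - 1 / 2" "q (1, 0) = (a + 1)\<^sup>2 + b\<^sup>2 - 1 / 2"
      "q (-1, 0) = (a - 1)\<^sup>2 + b\<^sup>2 - 1 / 2" "q (0, 1) = a\<^sup>2 + (b + 1)\<^sup>2 - 1 / 2"
      "q (0, -1) = a\<^sup>2 + (b - 1)\<^sup>2 - 1 / 2"
      using nz[of 0] nz[of "(1, 0)"] nz[of "(-1, 0)"] nz[of "(0, 1)"] nz[of "(0, -1)"]
      by (simp_all add: q_def nrm_square a_def b_def)
    have "q 0 ^ 4 - q (1, 0) * q (-1, 0) * q (0, 1) * q (0, -1) = 4 * (a\<^sup>2 - b\<^sup>2)\<^sup>2"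
      unfolding q_eq by algebra
    moreover have "0 \<le> 4 * (a\<^sup>2 - b\<^sup>2)\<^sup>2" by simp
    ultimately show ?thesis by linarith
  qed
  then have "ln (q (1, 0)) + ln (q (-1, 0)) + ln (q (0, 1)) + ln (q (0, -1)) \<le> 4 * ln (q 0)"
    by (rule four_ln_le(1)[OF q q q q q])
  moreover have "ln (q e) = 2 * log_super (w + e)" for e
    by (simp add: log_super_def q_def)
  ultimately show ?thesis
    by (simp add: nbr_sum_def)
qed

text \<open>Reflecting in the line of height \<open>-1\<close> rather than \<open>0\<close> leaves the Green kernel below
  enough room on \<open>L\<^sub>0\<close> to stay positive in spite of the approximations.\<close>

definition mirror :: "point \<Rightarrow> point" where
  "mirror w = (fst w, - snd w - 2)"

text \<open>Method of images. The two regularised logarithms are paired so that this kernel is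
  superharmonic on the half plane, even at \<open>w\<close>, while \<open>green_sub\<close> is
  subharmonic off \<open>w\<close>.\<close>

definition green_super :: "point \<Rightarrow> point \<Rightarrow> real" where
  "green_super w z = log_super (z - mirror w) - log_sub (z - w)"

definition green_sub :: "point \<Rightarrow> point \<Rightarrow> real" where
  "green_sub w z = log_sub (z - mirror w) - log_super (z - w)"

lemma nrm_mirror:
  "(nrm (z - mirror w))\<^sup>2 = (nrm (z - w))\<^sup>2 + 4 * (of_int (snd z) + 1) * (of_int (snd w) + 1)"
  by (simp add: nrm_square mirror_def) algebra

lemma nrm_mirror_diff: "nrm (mirror v - mirror w) = nrm (v - w)"
proof -
  have "(nrm (mirror v - mirror w))\<^sup>2 = (nrm (v - w))\<^sup>2"
    by (simp add: nrm_square mirror_def power2_commute)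
  then show ?thesis by simp
qed

lemma nrm_mirror_ge: "of_int (snd z + snd w + 2) \<le> nrm (z - mirror w)"
  using snd_le_nrm[of "z - mirror w"] by (simp add: mirror_def)

lemma nbr_sum_diff: "nbr_sum (\<lambda>u. f (u - a)) z = nbr_sum f (z - a)"
  by (simp add: nbr_sum_def algebra_simps)

lemma green_super_superharmonic:
  assumes "0 \<le> snd z" "0 \<le> snd w"
  shows "nbr_sum (green_super w) z \<le> 4 * green_super w z"
proof -
  have "nbr_sum (green_super w) z =
      nbr_sum (\<lambda>u. log_super (u - mirror w)) z - nbr_sum (\<lambda>u. log_sub (u - w)) z"
    by (simp add: nbr_sum_def green_super_def)
  moreover have "z - mirror w \<noteq> 0"
    using assms by (auto simp: mirror_def prod_eq_iff)
  ultimately show ?thesis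
    using log_super_superharmonic[of "z - mirror w"] log_sub_subharmonic[of "z - w"]
    by (simp add: nbr_sum_diff green_super_def)
qed

lemma green_sub_subharmonic:
  assumes "z \<noteq> w"
  shows "4 * green_sub w z \<le> nbr_sum (green_sub w) z"
proof -
  have "nbr_sum (green_sub w) z =
      nbr_sum (\<lambda>u. log_sub (u - mirror w)) z - nbr_sum (\<lambda>u. log_super (u - w)) z"
    by (simp add: nbr_sum_def green_sub_def)
  then show ?thesis
    using log_super_superharmonic[of "z - w"] log_sub_subharmonic[of "z - mirror w"] assms
    by (simp add: nbr_sum_diff green_sub_def)
qed

lemma four_le_heights:
  assumes "0 \<le> snd z" "0 \<le> snd w"
  shows "4 \<le> 4 * (real_of_int (snd z) + 1) * (of_int (snd w) + 1)"
proof -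
  have "1 * 1 \<le> (real_of_int (snd z) + 1) * (of_int (snd w) + 1)"
    using assms by (intro mult_mono) auto
  then show ?thesis by (simp add: algebra_simps)
qed

lemma green_super_eq:
  assumes "0 \<le> snd z" "0 \<le> snd w"
  shows "green_super w z = ln (1 + (4 * (of_int (snd z) + 1) * (of_int (snd w) + 1) - 1) /
    ((nrm (z - w))\<^sup>2 + 1 / 2)) / 2"
proof -
  let ?s = "4 * (real_of_int (snd z) + 1) * (of_int (snd w) + 1)" and ?d = "(nrm (z - w))\<^sup>2"
  have nz: "z - mirror w \<noteq> 0"
    using assms by (auto simp: mirror_def prod_eq_iff)
  have s: "4 \<le> ?s" by (rule four_le_heights[OF assms])
  have d: "0 < ?d + 1 / 2" by (simp add: add_nonneg_pos)
  have "1 + (?s - 1) / (?d + 1 / 2) = (?d + ?s - 1 / 2) / (?d + 1 / 2)"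
    using d by (simp add: field_simps)
  also have "ln \<dots> = ln (?d + ?s - 1 / 2) - ln (?d + 1 / 2)"
    using d s by (intro ln_divide_pos) auto
  finally show ?thesis
    using nz by (simp add: green_super_def log_super_def log_sub_def nrm_mirror diff_divide_distrib)
qed

lemma green_sub_eq:
  assumes "0 \<le> snd z" "0 \<le> snd w" "z \<noteq> w"
  shows "green_sub w z = ln (1 + (4 * (of_int (snd z) + 1) * (of_int (snd w) + 1) + 1) /
    ((nrm (z - w))\<^sup>2 - 1 / 2)) / 2"
proof -
  let ?s = "4 * (real_of_int (snd z) + 1) * (of_int (snd w) + 1)" and ?d = "(nrm (z - w))\<^sup>2"
  have "0 \<le> ?s" using assms by simp
  have "1\<^sup>2 \<le> ?d" using assms by (intro power_mono nrm_ge_1) auto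
  then have d: "0 < ?d - 1 / 2" by simp
  have "1 + (?s + 1) / (?d - 1 / 2) = (?d + ?s + 1 / 2) / (?d - 1 / 2)"
    using d by (simp add: field_simps)
  also have "ln \<dots> = ln (?d + ?s + 1 / 2) - ln (?d - 1 / 2)"
    using d \<open>0 \<le> ?s\<close> by (intro ln_divide_pos) auto
  finally show ?thesis
    using assms by (simp add: green_sub_def log_super_def log_sub_def nrm_mirror diff_divide_distrib)
qed

lemma green_super_nonneg:
  assumes "0 \<le> snd z" "0 \<le> snd w"
  shows "0 \<le> green_super w z"
proof -
  have "0 \<le> (4 * (real_of_int (snd z) + 1) * (of_int (snd w) + 1) - 1) / ((nrm (z - w))\<^sup>2 + 1 / 2)"
    using four_le_heights[OF assms] by (intro divide_nonneg_nonneg) auto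
  then show ?thesis by (simp add: green_super_eq[OF assms])
qed

section \<open>Relative comparison of the kernels far from the pole\<close>

lemma ln_mult_concave:
  fixes c t :: real
  assumes "0 \<le> c" "c \<le> 1" "0 \<le> t"
  shows "c * ln (1 + t) \<le> ln (1 + c * t)"
proof -
  define g where "g u = ln (1 + c * u) - c * ln (1 + u)" for u :: real
  have "g 0 \<le> g t"
  proof (rule DERIV_nonneg_imp_nondecreasing[where f = g])
    fix u assume u: "0 \<le> u" "u \<le> t"
    have p: "0 < 1 + c * u" using u assms by (simp add: add_pos_nonneg)
    have "(g has_real_derivative (c / (1 + c * u) - c / (1 + u))) (at u)"
      unfolding g_def[abs_def] using u p by (auto intro!: derivative_eq_intros simp: field_simps)
    moreover have "c / (1 + u) \<le> c / (1 + c * u)"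
      using u p assms mult_right_mono[of c 1 u] by (intro divide_left_mono mult_pos_pos) auto
    ultimately show "\<exists>y. (g has_real_derivative y) (at u) \<and> 0 \<le> y"
      by (intro exI[of _ "c / (1 + c * u) - c / (1 + u)"]) simp
  qed (use assms in auto)
  then show ?thesis by (simp add: g_def)
qed

lemma ln_mult_le:
  fixes c t :: real
  assumes "1 \<le> c" "0 \<le> t"
  shows "ln (1 + c * t) \<le> c * ln (1 + t)"
proof -
  have "1 / c * ln (1 + c * t) \<le> ln (1 + 1 / c * (c * t))"
    using assms by (intro ln_mult_concave) auto
  then show ?thesis using assms by (simp add: field_simps)
qed

text \<open>\<open>Z\<close>, \<open>W\<close> and \<open>h + 1\<close> stand for the heights of z,
  w and x plus one, \<open>\<rho>\<close> and \<open>r\<close> for the distances from z to w and to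
  x. With y = m / n, the numerator changes by a factor between 1 - y/16 and 1 + y/10, the
  denominator by one between 1 - y/2 and 1 + y.\<close>

lemma far_ratio:
  fixes Z W h n m r \<rho> :: real
  assumes "1 \<le> Z" "1 \<le> m" "m \<le> n" "16 * n \<le> h" "4 * n \<le> r"
    and W: "\<bar>W - (h + 1)\<bar> \<le> m" and \<rho>: "\<bar>\<rho> - r\<bar> \<le> m"
  defines "t \<equiv> (4 * Z * (h + 1) - 1) / (r\<^sup>2 + 1 / 2)"
  shows "(4 * Z * W + 1) / (\<rho>\<^sup>2 - 1 / 2) \<le> (1 + 2 * m / n) * t"
    and "(1 - 2 * m / n) * t \<le> (4 * Z * W + 1) / (\<rho>\<^sup>2 - 1 / 2)"
    and "0 \<le> t"
proof -
  define y where "y = m / n"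
  have y: "0 < y" "y \<le> 1" "m = y * n" using assms by (simp_all add: y_def)
  define P where "P = 4 * Z * (h + 1) - 1"
  define D where "D = r\<^sup>2 + 1 / 2"
  have D: "0 < D" by (simp add: D_def add_nonneg_pos)
  have Zh: "64 * (Z * n) \<le> 4 * (Z * h)" using assms mult_left_mono[of "16 * n" h Z] by simp
  have "P = 4 * (Z * h) + 4 * Z - 1" by (simp add: P_def algebra_simps)
  then have P: "64 * (Z * n) \<le> P" using Zh assms(1) by linarith
  have Pm: "64 * (Z * m) \<le> y * P"
    using P y mult_left_mono[of "64 * (Z * n)" P y] by (simp add: mult_ac)
  have Zm: "1 \<le> Z * m" using assms mult_mono[of 1 Z 1 m] by simp
  have P0: "0 < P" using P assms by (smt (verit) mult_pos_pos)
  have ZW: "\<bar>Z * W - Z * (h + 1)\<bar> \<le> Z * m"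
    using mult_left_mono[OF W, of Z] assms by (simp add: abs_mult flip: right_diff_distrib)
  have num1: "4 * Z * W + 1 \<le> (1 + y / 10) * P"
  proof -
    have "4 * Z * W + 1 \<le> P + 4 * (Z * m) + 2"
      using ZW unfolding P_def mult.assoc by argo
    moreover have "(1 + y / 10) * P = P + y * P / 10" by (simp add: algebra_simps)
    ultimately show ?thesis using Pm Zm by linarith
  qed
  have num2: "(1 - y / 16) * P \<le> 4 * Z * W + 1"
  proof -
    have "P - 4 * (Z * m) \<le> 4 * Z * W + 1"
      using ZW unfolding P_def mult.assoc by argo
    moreover have "(1 - y / 16) * P = P - y * P / 16" by (simp add: algebra_simps)
    ultimately show ?thesis using Pm by linarith
  qed
  have my: "4 * m \<le> y * r" using assms y mult_left_mono[of "4 * n" r y] by simp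
  have r0: "0 < r" using assms by simp
  have rm: "4 * (r * m) \<le> y * r\<^sup>2"
    using mult_left_mono[OF my, of r] r0 by (simp add: power2_eq_square mult_ac)
  have mm: "16 * m\<^sup>2 \<le> y * r\<^sup>2"
  proof -
    have "(4 * m)\<^sup>2 \<le> (y * r)\<^sup>2" using my assms by (intro power_mono) auto
    also have "\<dots> = y * (y * r\<^sup>2)" by (simp add: power2_eq_square mult_ac)
    also have "\<dots> \<le> 1 * (y * r\<^sup>2)" using y by (intro mult_right_mono) auto
    finally show ?thesis by (simp add: power2_eq_square)
  qed
  have m2: "1 \<le> m\<^sup>2" using assms by simp
  have den1: "(1 - y / 2) * D \<le> \<rho>\<^sup>2 - 1 / 2"
  proof -
    have "(r - m)\<^sup>2 \<le> \<rho>\<^sup>2" using \<rho> assms by (intro power_mono) auto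
    moreover have "(r - m)\<^sup>2 = r\<^sup>2 - 2 * (r * m) + m\<^sup>2" by (simp add: power2_diff)
    moreover have "(1 - y / 2) * D \<le> r\<^sup>2 + 1 / 2 - y * r\<^sup>2 / 2"
      using y by (simp add: D_def algebra_simps)
    ultimately show ?thesis using rm m2 by linarith
  qed
  have den2: "\<rho>\<^sup>2 - 1 / 2 \<le> (1 + y) * D"
  proof -
    have "\<rho>\<^sup>2 \<le> (r + m)\<^sup>2" using \<rho> assms by (intro power_mono) auto
    moreover have "(r + m)\<^sup>2 = r\<^sup>2 + 2 * (r * m) + m\<^sup>2" by (simp add: power2_sum)
    moreover have "r\<^sup>2 + y * r\<^sup>2 \<le> (1 + y) * D"
      using y by (simp add: D_def algebra_simps)
    moreover have "0 \<le> y * r\<^sup>2" using y by simp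
    ultimately show ?thesis using rm mm by linarith
  qed
  have den0: "0 < (1 - y / 2) * D" using y D by simp
  have t: "t = P / D" by (simp add: t_def P_def D_def)
  show "0 \<le> t" using P0 D by (simp add: t)
  have "(4 * Z * W + 1) / (\<rho>\<^sup>2 - 1 / 2) \<le> ((1 + y / 10) * P) / ((1 - y / 2) * D)"
    using num1 den1 den0 P0 y by (intro frac_le) auto
  also have "\<dots> = (1 + y / 10) / (1 - y / 2) * t" by (simp add: t)
  also have "\<dots> \<le> (1 + 2 * y) * t"
  proof (rule mult_right_mono[OF _ \<open>0 \<le> t\<close>])
    have "y * y \<le> y" using y by (simp add: mult_left_le)
    moreover have "(1 + 2 * y) * (1 - y / 2) = 1 + 3 / 2 * y - y * y" by (simp add: algebra_simps)
    ultimately have "1 + y / 10 \<le> (1 + 2 * y) * (1 - y / 2)" using y by linarith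
    then show "(1 + y / 10) / (1 - y / 2) \<le> 1 + 2 * y"
      using y by (simp add: pos_divide_le_eq)
  qed
  finally show "(4 * Z * W + 1) / (\<rho>\<^sup>2 - 1 / 2) \<le> (1 + 2 * m / n) * t" by (simp add: y_def)
  have "(1 - 2 * y) * t \<le> (1 - y / 16) / (1 + y) * t"
  proof (rule mult_right_mono[OF _ \<open>0 \<le> t\<close>])
    have "(1 - 2 * y) * (1 + y) \<le> 1 - y / 16" using y by (simp add: algebra_simps)
    then show "1 - 2 * y \<le> (1 - y / 16) / (1 + y)" using y by (simp add: pos_le_divide_eq)
  qed
  also have "\<dots> = ((1 - y / 16) * P) / ((1 + y) * D)" by (simp add: t)
  also have "\<dots> \<le> (4 * Z * W + 1) / (\<rho>\<^sup>2 - 1 / 2)"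
  proof (rule frac_le[OF _ num2 _ den2])
    have "0 \<le> (1 - y / 16) * P" using P0 y by simp
    then show "0 \<le> 4 * Z * W + 1" using num2 by linarith
    show "0 < \<rho>\<^sup>2 - 1 / 2" using den0 den1 by linarith
  qed
  finally show "(1 - 2 * m / n) * t \<le> (4 * Z * W + 1) / (\<rho>\<^sup>2 - 1 / 2)" by (simp add: y_def)
qed

lemma green_far:
  fixes m n :: real
  assumes "0 \<le> snd z" "1 \<le> m" "m \<le> n" "16 * n \<le> of_int (snd x)" "4 * n \<le> nrm (z - x)"
    and w: "nrm (w - x) \<le> m"
  shows "\<bar>green_sub w z - green_super x z\<bar> \<le> 2 * m / n * green_super x z"
proof -
  let ?Z = "real_of_int (snd z) + 1" and ?W = "real_of_int (snd w) + 1" and ?h = "real_of_int (snd x)"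
  define t where "t = (4 * ?Z * (?h + 1) - 1) / ((nrm (z - x))\<^sup>2 + 1 / 2)"
  define s where "s = (4 * ?Z * ?W + 1) / ((nrm (z - w))\<^sup>2 - 1 / 2)"
  have sw: "\<bar>real_of_int (snd w) - ?h\<bar> \<le> m"
    using snd_le_nrm[of "w - x"] w by simp
  have "0 \<le> real_of_int (snd w)" using sw assms by linarith
  then have w0: "0 \<le> snd w" by simp
  have "0 \<le> ?h" using assms by linarith
  then have x0: "0 \<le> snd x" by simp
  have \<rho>: "\<bar>nrm (z - w) - nrm (z - x)\<bar> \<le> m"
    using nrm_diff_le[of w z x] w by (simp add: nrm_minus[of w z] nrm_minus[of x z])
  have zw: "z \<noteq> w" using w assms by auto
  have Z: "1 \<le> ?Z" and W: "\<bar>?W - (?h + 1)\<bar> \<le> m" using assms sw by auto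
  have ratio: "s \<le> (1 + 2 * m / n) * t" "(1 - 2 * m / n) * t \<le> s" "0 \<le> t"
    unfolding s_def t_def by (fact far_ratio[OF Z assms(2-5) W \<rho>])+
  have super: "green_super x z = ln (1 + t) / 2"
    unfolding t_def by (rule green_super_eq) (use assms x0 in auto)
  have sub: "green_sub w z = ln (1 + s) / 2"
    unfolding s_def by (rule green_sub_eq) (use assms w0 zw in auto)
  have s0: "0 \<le> s"
  proof -
    have "1\<^sup>2 \<le> (nrm (z - w))\<^sup>2" using zw by (intro power_mono nrm_ge_1) auto
    then show ?thesis using assms w0 unfolding s_def by (intro divide_nonneg_nonneg) auto
  qed
  have mn: "0 \<le> 2 * m / n" using assms by simp
  have "ln (1 + s) \<le> ln (1 + (1 + 2 * m / n) * t)"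
    using ratio s0 by (intro ln_mono) auto
  also have "\<dots> \<le> (1 + 2 * m / n) * ln (1 + t)"
    using ratio mn by (intro ln_mult_le) auto
  finally have "ln (1 + s) \<le> (1 + 2 * m / n) * ln (1 + t)" .
  moreover have "(1 - 2 * m / n) * ln (1 + t) \<le> ln (1 + s)"
  \<comment> \<open>Only \<open>m \<le> n\<close> is known, so this factor can be negative; the
    lower bound is then trivial.\<close>
  proof (cases "1 - 2 * m / n \<ge> 0")
    case True
    have "(1 - 2 * m / n) * ln (1 + t) \<le> ln (1 + (1 - 2 * m / n) * t)"
      using True mn ratio by (intro ln_mult_concave) auto
    also have "\<dots> \<le> ln (1 + s)"
      using ratio True by (intro ln_mono) (auto intro: add_pos_nonneg)
    finally show ?thesis .
  next
    case False
    then have "(1 - 2 * m / n) * ln (1 + t) \<le> 0"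
      using ratio by (intro mult_nonpos_nonneg) auto
    also have "0 \<le> ln (1 + s)" using s0 by simp
    finally show ?thesis .
  qed
  ultimately have "\<bar>ln (1 + s) - ln (1 + t)\<bar> \<le> 2 * m / n * ln (1 + t)"
    by (simp add: left_diff_distrib distrib_right abs_le_iff)
  moreover have "\<bar>ln (1 + s) / 2 - ln (1 + t) / 2\<bar> = \<bar>ln (1 + s) - ln (1 + t)\<bar> / 2"
    by (simp flip: diff_divide_distrib)
  ultimately have "\<bar>ln (1 + s) / 2 - ln (1 + t) / 2\<bar> \<le> 2 * m / n * ln (1 + t) / 2"
    by (simp only: divide_right_mono zero_le_numeral)
  then show ?thesis by (simp add: sub super)
qed

section \<open>Comparison of the regularised logarithms with ln\<close>

lemma log_sub_ge_ln:
  assumes "w \<noteq> 0" shows "ln (nrm w) \<le> log_sub w"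
proof -
  have w: "1 \<le> nrm w" using assms by (rule nrm_ge_1)
  have "ln ((nrm w)\<^sup>2) \<le> ln ((nrm w)\<^sup>2 + 1 / 2)" using w by (intro ln_mono) auto
  then show ?thesis using w by (simp add: log_sub_def ln_realpow)
qed

lemma log_sub_le:
  assumes "w \<noteq> 0" shows "log_sub w \<le> ln (nrm w) + 1 / (4 * (nrm w)\<^sup>2)"
proof -
  have w: "1 \<le> nrm w" using assms by (rule nrm_ge_1)
  have "(nrm w)\<^sup>2 + 1 / 2 = (nrm w)\<^sup>2 * (1 + 1 / (2 * (nrm w)\<^sup>2))"
    using w by (simp add: field_simps)
  then have "ln ((nrm w)\<^sup>2 + 1 / 2) = ln ((nrm w)\<^sup>2) + ln (1 + 1 / (2 * (nrm w)\<^sup>2))"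
    using w by (simp only:) (intro ln_mult_pos; auto intro: add_pos_nonneg)
  also have "ln (1 + 1 / (2 * (nrm w)\<^sup>2)) \<le> 1 / (2 * (nrm w)\<^sup>2)"
    by (intro ln_add_one_self_le_self) simp
  also have "ln ((nrm w)\<^sup>2) = 2 * ln (nrm w)" using w by (simp add: ln_realpow)
  finally show ?thesis by (simp add: log_sub_def)
qed

lemma ln_le_log_super:
  fixes d :: real
  assumes "1 \<le> d" "d + 1 \<le> nrm w"
  shows "ln d \<le> log_super w"
proof -
  have w: "w \<noteq> 0" using assms by auto
  have "(d + 1)\<^sup>2 \<le> (nrm w)\<^sup>2" using assms by (intro power_mono) auto
  then have "d\<^sup>2 \<le> (nrm w)\<^sup>2 - 1 / 2" using assms by (simp add: power2_sum)
  then have "ln (d\<^sup>2) \<le> ln ((nrm w)\<^sup>2 - 1 / 2)" using assms by (intro ln_mono) auto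
  then show ?thesis using w assms by (simp add: log_super_def ln_realpow)
qed

text \<open>For \<open>w = 0\<close> the loss is (ln 126) / 2, at most 7/2, against at least 11/2.
  Otherwise it is at most 7 / (2 D) with D = \<open>nrm w\<close>, and 1 + |r - j| is at most D + 2,
  hence at most 3 D; 11 exceeds 21/2.\<close>

lemma log_super_ge:
  fixes r d :: real
  assumes r: "\<bar>r - d\<bar> \<le> nrm w" and d: "real j \<le> d" "d < real j + 1"
  shows "ln (1 + \<bar>r - d\<bar>) - 11 / (1 + \<bar>r - real j\<bar>) \<le> log_super w"
proof (cases "w = 0")
  case True
  have "\<bar>r - real j\<bar> \<le> 1" "r = d" using r d True by auto
  have "r - real j < 1" "0 \<le> r - real j" using d \<open>r = d\<close> by auto
  then have "11 / 2 \<le> 11 / (1 + \<bar>r - real j\<bar>)" by (intro divide_left_mono) auto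
  moreover have "ln (126 :: real) \<le> 7 * ln 2"
  proof -
    have "ln (126 :: real) \<le> ln (2 ^ 7)" by (intro ln_mono) auto
    also have "\<dots> = 7 * ln 2" by (subst ln_realpow) auto
    finally show ?thesis .
  qed
  moreover have "ln 2 \<le> (1 :: real)" using ln_le_minus_one[of "2 :: real"] by simp
  ultimately show ?thesis using True \<open>r = d\<close> by (simp add: log_super_def ln_div)
next
  case False
  define D where "D = nrm w"
  have D: "1 \<le> D" using nrm_ge_1[OF False] by (simp add: D_def)
  have "1\<^sup>2 \<le> D\<^sup>2" using D by (intro power_mono) auto
  then have D2: "0 < D\<^sup>2 - 1 / 2" unfolding one_power2 by linarith
  have "(D + 1)\<^sup>2 \<le> (D\<^sup>2 - 1 / 2) * (1 + 7 / D)"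
  proof -
    have "(D\<^sup>2 - 1 / 2) * (1 + 7 / D) = D\<^sup>2 + 7 * D - 1 / 2 - 7 / 2 / D"
      using D by (simp add: field_simps power2_eq_square)
    moreover have "7 / 2 / D \<le> 7 / 2" using D by (simp add: divide_le_eq)
    moreover have "(D + 1)\<^sup>2 = D\<^sup>2 + 2 * D + 1" by (simp add: power2_sum)
    ultimately show ?thesis using D by linarith
  qed
  then have "ln ((D + 1)\<^sup>2) \<le> ln ((D\<^sup>2 - 1 / 2) * (1 + 7 / D))"
    using D by (intro ln_mono) auto
  also have "\<dots> = ln (D\<^sup>2 - 1 / 2) + ln (1 + 7 / D)"
    using D D2 by (intro ln_mult_pos) (auto intro: add_pos_nonneg)
  also have "ln (1 + 7 / D) \<le> 7 / D" using D by (intro ln_add_one_self_le_self) auto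
  finally have "2 * ln (D + 1) \<le> 2 * log_super w + 7 / D"
    using False D by (simp add: log_super_def D_def ln_realpow)
  moreover have "ln (1 + \<bar>r - d\<bar>) \<le> ln (D + 1)"
    using r by (intro ln_mono) (auto simp: D_def)
  moreover have "7 / 2 / D \<le> 11 / (1 + \<bar>r - real j\<bar>)"
  proof -
    have "1 + \<bar>r - real j\<bar> \<le> D + 2" using r d by (auto simp: D_def)
    then have "7 * (1 + \<bar>r - real j\<bar>) \<le> 7 * (D + 2)" by simp
    also have "\<dots> \<le> 22 * D" using D by simp
    finally show ?thesis using D by (simp add: field_simps)
  qed
  ultimately show ?thesis by linarith
qed

lemma log_sub_smooth:
  fixes m h :: real
  assumes "1 \<le> m" "m \<le> h" "h \<le> nrm v" "nrm (u - v) \<le> m"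
  shows "log_sub u \<le> log_super v + 4 * m / h"
proof -
  define D where "D = nrm v"
  have D: "1 \<le> D" "m \<le> D" "h \<le> D" using assms by (auto simp: D_def)
  have v: "v \<noteq> 0" using D by (auto simp: D_def)
  have "1\<^sup>2 \<le> D\<^sup>2" using D by (intro power_mono) auto
  then have D2: "0 < D\<^sup>2 - 1 / 2" unfolding one_power2 by linarith
  have "nrm u \<le> D + m" using nrm_triangle[of v "u - v"] assms by (simp add: D_def)
  then have "(nrm u)\<^sup>2 \<le> (D + m)\<^sup>2" by (intro power_mono) auto
  moreover have "(D + m)\<^sup>2 = D\<^sup>2 + 2 * (D * m) + m\<^sup>2" by (simp add: power2_sum)
  moreover have "m\<^sup>2 \<le> D * m" using D assms by (simp add: power2_eq_square mult_right_mono)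
  moreover have "1 \<le> D * m" using D assms mult_mono[of 1 D 1 m] by simp
  ultimately have "(nrm u)\<^sup>2 + 1 / 2 \<le> (D\<^sup>2 - 1 / 2) + 4 * (D * m)" by linarith
  also have "\<dots> = (D\<^sup>2 - 1 / 2) * (1 + 4 * (D * m) / (D\<^sup>2 - 1 / 2))"
    using D2 by (simp add: distrib_left)
  finally have 1: "ln ((nrm u)\<^sup>2 + 1 / 2) \<le> ln ((D\<^sup>2 - 1 / 2) * (1 + 4 * (D * m) / (D\<^sup>2 - 1 / 2)))"
    by (intro ln_mono) (auto intro: add_nonneg_pos)
  have q: "0 \<le> 4 * (D * m) / (D\<^sup>2 - 1 / 2)"
    using D D2 assms by (intro divide_nonneg_pos) auto
  note 1
  also have "ln ((D\<^sup>2 - 1 / 2) * (1 + 4 * (D * m) / (D\<^sup>2 - 1 / 2))) =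
      ln (D\<^sup>2 - 1 / 2) + ln (1 + 4 * (D * m) / (D\<^sup>2 - 1 / 2))"
    by (intro ln_mult_pos D2 add_pos_nonneg q) simp
  also have "ln (1 + 4 * (D * m) / (D\<^sup>2 - 1 / 2)) \<le> 4 * (D * m) / (D\<^sup>2 - 1 / 2)"
    by (intro ln_add_one_self_le_self q)
  also have "\<dots> \<le> 4 * (D * m) / (D\<^sup>2 / 2)"
    using D D2 assms by (intro divide_left_mono) auto
  also have "\<dots> = 8 * m / D" using D by (simp add: power2_eq_square)
  also have "\<dots> \<le> 8 * m / h" using D assms by (intro divide_left_mono) auto
  finally show ?thesis using v by (simp add: log_super_def log_sub_def D_def)
qed

lemma green_super_ge:
  fixes n :: real
  assumes "0 \<le> snd z" "1 \<le> n" "16 * n \<le> of_int (snd x)" "nrm (z - x) \<le> 4 * n"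
  shows "ln 2 \<le> green_super x z"
    and "z \<noteq> x \<Longrightarrow> ln n - ln (nrm (z - x)) + ln 8 \<le> green_super x z"
proof -
  let ?r = "nrm (z - x)"
  have "16 * n + 1 \<le> nrm (z - mirror x)"
    using nrm_mirror_ge[of z x] assms by simp
  then have "ln (16 * n) \<le> log_super (z - mirror x)"
    using assms by (intro ln_le_log_super) auto
  \<comment> \<open>The spare \<open>ln 2\<close> absorbs the error
    \<open>1 / (4 * ?r\<^sup>2)\<close>, at most 1/4, of \<open>log_sub\<close>.\<close>
  moreover have "ln (16 * n) = ln n + ln 8 + ln 2"
  proof -
    have "ln (n * 8 * 2) = ln n + ln 8 + ln 2" using assms by (simp only: ln_mult) simp
    then show ?thesis by (simp add: mult.commute)
  qed
  ultimately have a: "ln n + ln 8 + ln 2 \<le> log_super (z - mirror x)" by simp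
  have l: "2 / 3 \<le> ln (2 :: real)" by (rule ln2_ge_two_thirds)
  have near: "ln n - ln ?r + ln 8 \<le> green_super x z" if "z \<noteq> x"
  proof -
    have "1 \<le> ?r" using that by (intro nrm_ge_1) simp
    then have "1\<^sup>2 \<le> ?r\<^sup>2" by (intro power_mono) auto
    then have "1 / (4 * ?r\<^sup>2) \<le> 1 / (4 * 1)" by (intro frac_le) auto
    moreover have "log_sub (z - x) \<le> ln ?r + 1 / (4 * ?r\<^sup>2)"
      using that by (intro log_sub_le) simp
    ultimately show ?thesis using a l by (simp add: green_super_def)
  qed
  then show "z \<noteq> x \<Longrightarrow> ln n - ln ?r + ln 8 \<le> green_super x z" .
  show "ln 2 \<le> green_super x z"
  proof (cases "z = x")
    case True
    have "0 \<le> ln n" "(0 :: real) \<le> ln 8" using assms by auto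
    moreover have "log_sub (z - x) = - ln 2 / 2" using True by (simp add: log_sub_def ln_div)
    ultimately show ?thesis
      using a l unfolding green_super_def by linarith
  next
    case False
    have "1 \<le> ?r" using False by (intro nrm_ge_1) simp
    then have "ln ?r \<le> ln (4 * n)" using assms by (intro ln_mono) auto
    also have "ln (4 * n) = ln 4 + ln n" using assms by (simp add: ln_mult)
    finally have "ln ?r \<le> ln 4 + ln n" .
    moreover have "ln (8 :: real) = ln 4 + ln 2" using ln_mult[of "4 :: real" 2] by simp
    ultimately show ?thesis using near[OF False] by linarith
  qed
qed

subsection \<open>The barrier\<close>

text \<open>The factor \<open>60\<close> is \<open>J\<^sup>1\<^sup>/\<^sup>2\<close> for \<open>J = 3600\<close>, which is large enough for the slack to beat the
  discretization error. The total mass of the weights is \<open>1 - 60 / n\<^sup>1\<^sup>/\<^sup>2\<close>, so the first kernel has an excess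
  of \<open>600 / n\<^sup>1\<^sup>/\<^sup>2\<close>, which covers the truncation at \<open>n\<close>.\<close>

definition barrier :: "point \<Rightarrow> (nat \<Rightarrow> point) \<Rightarrow> nat \<Rightarrow> point \<Rightarrow> real" where
  "barrier x y n z = (1 + 540 / sqrt n) * green_super x z -
    60 * (\<Sum>j=3600..<n. weight j * green_sub (y j) z)"

lemma sqrt_3600: "sqrt 3600 = 60"
  by (rule real_sqrt_unique) auto

lemma sum_weight_3600: "3600 \<le> n \<Longrightarrow> 60 * (\<Sum>j=3600..<n. weight j) = 1 - 60 / sqrt n"
  by (simp add: sum_weight sqrt_3600 right_diff_distrib)

lemma barrier_superharmonic:
  assumes "0 \<le> snd z" "0 \<le> snd x" "\<And>j. 3600 \<le> j \<Longrightarrow> j < n \<Longrightarrow> z \<noteq> y j"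
  shows "nbr_sum (barrier x y n) z \<le> 4 * barrier x y n z"
proof -
  let ?A = "1 + 540 / sqrt n"
  have "nbr_sum (barrier x y n) z = ?A * nbr_sum (green_super x) z -
      60 * (\<Sum>j=3600..<n. weight j * nbr_sum (green_sub (y j)) z)"
    unfolding nbr_sum_def barrier_def by (simp add: algebra_simps sum.distrib)
  moreover have "?A * nbr_sum (green_super x) z \<le> ?A * (4 * green_super x z)"
    using assms by (intro mult_left_mono green_super_superharmonic) (auto intro: add_nonneg_nonneg)
  moreover have "(\<Sum>j=3600..<n. weight j * (4 * green_sub (y j) z)) \<le>
      (\<Sum>j=3600..<n. weight j * nbr_sum (green_sub (y j)) z)"
    using assms by (intro sum_mono mult_left_mono green_sub_subharmonic weight_nonneg) auto
  moreover have "(\<Sum>j=3600..<n. weight j * (4 * green_sub (y j) z)) =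
      4 * (\<Sum>j=3600..<n. weight j * green_sub (y j) z)"
    by (simp add: sum_distrib_left mult_ac)
  ultimately show ?thesis by (simp add: barrier_def algebra_simps)
qed

text \<open>The net mass is 600 / \<open>sqrt n\<close>. Replacing every
  \<open>green_sub (y j)\<close> by \<open>green_super x\<close> costs at most 240 /
  \<open>sqrt n\<close>: 60 times the first moment 2 \<open>sqrt n\<close> times 2 / n. What remains
  lies between 360 and 840 over \<open>sqrt n\<close>.\<close>

lemma barrier_far:
  assumes z: "0 \<le> snd z" and n: "3600 \<le> n" and x: "16 * int n \<le> snd x"
    and far: "4 * real n \<le> nrm (z - x)"
    and y: "\<And>j. 3600 \<le> j \<Longrightarrow> j < n \<Longrightarrow> nrm (y j - x) < real j + 1"
  shows "0 \<le> barrier x y n z" and "barrier x y n z \<le> 840 / sqrt n * green_super x z"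
proof -
  let ?K = "green_super x z" and ?S = "\<Sum>j=3600..<n. weight j * green_sub (y j) z"
  have x0: "0 \<le> snd x" using x by linarith
  have K: "0 \<le> ?K" using z x0 by (rule green_super_nonneg)
  have h: "16 * real n \<le> of_int (snd x)" using x by linarith
  have "\<bar>?S - (\<Sum>j=3600..<n. weight j) * ?K\<bar> =
      \<bar>\<Sum>j=3600..<n. weight j * (green_sub (y j) z - ?K)\<bar>"
    by (simp add: right_diff_distrib sum_subtractf sum_distrib_right)
  also have "\<dots> \<le> (\<Sum>j=3600..<n. \<bar>weight j * (green_sub (y j) z - ?K)\<bar>)"
    by (rule sum_abs)
  also have "\<dots> \<le> (\<Sum>j=3600..<n. weight j * (real j + 1) * (2 / n * ?K))"
  proof (rule sum_mono)
    fix j assume "j \<in> {3600..<n}"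
    then have j: "3600 \<le> j" "j < n" by auto
    have "\<bar>green_sub (y j) z - ?K\<bar> \<le> 2 * (real j + 1) / n * ?K"
      using y[OF j] z n h far j by (intro green_far) auto
    also have "2 * (real j + 1) / n * ?K = (real j + 1) * (2 / n * ?K)"
      by (simp only: times_divide_eq_left times_divide_eq_right mult_ac)
    finally have "weight j * \<bar>green_sub (y j) z - ?K\<bar> \<le> weight j * ((real j + 1) * (2 / n * ?K))"
      using j by (intro mult_left_mono weight_nonneg) auto
    then show "\<bar>weight j * (green_sub (y j) z - ?K)\<bar> \<le> weight j * (real j + 1) * (2 / n * ?K)"
      using weight_nonneg[of j] j by (simp only: abs_mult abs_of_nonneg mult.assoc)
  qed
  also have "\<dots> = (\<Sum>j=3600..<n. weight j * (real j + 1)) * (2 / n * ?K)"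
    by (simp only: sum_distrib_right)
  also have "\<dots> \<le> 2 * sqrt n * (2 / n * ?K)"
    using K by (intro mult_right_mono sum_weight_mult_le) auto
  also have "\<dots> = 4 / sqrt n * ?K"
    using real_div_sqrt[of "real n"] n by (simp add: field_simps)
  finally have "\<bar>?S - (\<Sum>j=3600..<n. weight j) * ?K\<bar> \<le> 4 / sqrt n * ?K" .
  then have "\<bar>60 * ?S - 60 * (\<Sum>j=3600..<n. weight j) * ?K\<bar> \<le> 240 / sqrt n * ?K"
    by (simp add: abs_le_iff)
  then have S: "\<bar>60 * ?S - (1 - 60 / sqrt n) * ?K\<bar> \<le> 240 / sqrt n * ?K"
    unfolding sum_weight_3600[OF n] .
  define s where "s = ?K / sqrt n"
  have s: "0 \<le> s" using K by (simp add: s_def)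
  have "\<bar>60 * ?S - (?K - 60 * s)\<bar> \<le> 240 * s"
    using S by (simp add: s_def left_diff_distrib)
  moreover have "barrier x y n z = ?K + 540 * s - 60 * ?S"
    by (simp add: barrier_def s_def distrib_right)
  moreover have "840 / sqrt n * ?K = 840 * s" by (simp add: s_def)
  ultimately show "0 \<le> barrier x y n z" "barrier x y n z \<le> 840 / sqrt n * ?K"
    using s by linarith+
qed

text \<open>The mirror image of \<open>x\<close> is at distance at least 16 n from \<open>z\<close>,
  so by \<open>log_sub_smooth\<close> all image charges can be moved there at a cost controlled by
  the first moment.\<close>

lemma sum_log_sub_le:
  assumes z: "0 \<le> snd z" and n: "3600 \<le> n" and x: "16 * int n \<le> snd x"
    and y: "\<And>j. 3600 \<le> j \<Longrightarrow> j < n \<Longrightarrow> nrm (y j - x) < real j + 1"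
  shows "60 * (\<Sum>j=3600..<n. weight j * log_sub (z - mirror (y j))) \<le>
    (1 - 60 / sqrt n) * log_super (z - mirror x) + 30 / sqrt n"
proof -
  let ?P = "log_super (z - mirror x)"
  have h: "16 * real n \<le> of_int (snd x)" using x by linarith
  have D: "16 * real n \<le> nrm (z - mirror x)"
    using nrm_mirror_ge[of z x] z h by simp
  have "(\<Sum>j=3600..<n. weight j * log_sub (z - mirror (y j))) \<le>
      (\<Sum>j=3600..<n. weight j * ?P + weight j * (real j + 1) * (4 / (16 * n)))"
  proof (rule sum_mono)
    fix j assume "j \<in> {3600..<n}"
    then have j: "3600 \<le> j" "j < n" by auto
    have "nrm ((z - mirror (y j)) - (z - mirror x)) = nrm (y j - x)"
      using nrm_mirror_diff[of x "y j"] by (simp add: nrm_minus[of x])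
    then have "log_sub (z - mirror (y j)) \<le> ?P + 4 * (real j + 1) / (16 * n)"
      using y[OF j] j D by (intro log_sub_smooth) auto
    also have "4 * (real j + 1) / (16 * n) = (real j + 1) * (4 / (16 * n))"
      by (simp only: times_divide_eq_right mult.commute)
    finally have "weight j * log_sub (z - mirror (y j)) \<le> weight j * (?P + (real j + 1) * (4 / (16 * n)))"
      using j by (intro mult_left_mono weight_nonneg) auto
    then show "weight j * log_sub (z - mirror (y j)) \<le>
        weight j * ?P + weight j * (real j + 1) * (4 / (16 * n))"
      by (simp only: distrib_left[of _ ?P] mult.assoc)
  qed
  also have "\<dots> = (\<Sum>j=3600..<n. weight j) * ?P +
      (\<Sum>j=3600..<n. weight j * (real j + 1)) * (4 / (16 * n))"
    by (simp only: sum.distrib sum_distrib_right)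
  also have "(\<Sum>j=3600..<n. weight j * (real j + 1)) * (4 / (16 * n)) \<le> 2 * sqrt n * (4 / (16 * n))"
    by (intro mult_right_mono sum_weight_mult_le) auto
  also have "2 * sqrt n * (4 / (16 * n)) = 1 / 2 / sqrt n"
    using real_div_sqrt[of "real n"] n by (simp add: field_simps)
  finally have "60 * (\<Sum>j=3600..<n. weight j * log_sub (z - mirror (y j))) \<le>
      60 * (\<Sum>j=3600..<n. weight j) * ?P + 30 / sqrt n"
    by simp
  then show ?thesis unfolding sum_weight_3600[OF n] .
qed

text \<open>Images and poles are treated apart: \<open>sum_log_sub_le\<close> bounds the images, the
  half-line inequality bounds the poles through |z - y| >= ||z - x| - |y - x||. The main terms
  cancel, leaving a multiple of \<open>1 / sqrt n\<close>.\<close>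

lemma barrier_near:
  assumes z: "0 \<le> snd z" and n: "3600 \<le> n" and x: "16 * int n \<le> snd x"
    and near: "nrm (z - x) \<le> 4 * real n" and zx: "z \<noteq> x"
    and y: "\<And>j. 3600 \<le> j \<Longrightarrow> j < n \<Longrightarrow> real j \<le> nrm (y j - x) \<and> nrm (y j - x) < real j + 1"
  shows "0 \<le> barrier x y n z"
proof -
  let ?K = "green_super x z" and ?P = "log_super (z - mirror x)" and ?S = "log_sub (z - x)"
  let ?U = "\<Sum>j=3600..<n. weight j * log_sub (z - mirror (y j))"
  let ?V = "\<Sum>j=3600..<n. weight j * log_super (z - y j)"
  define r where "r = nrm (z - x)"
  have r: "1 \<le> r" using zx unfolding r_def by (intro nrm_ge_1) simp
  have h: "16 * real n \<le> of_int (snd x)" using x by linarith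
  have K: "ln 2 \<le> ?K" "ln n - ln r + ln 8 \<le> ?K"
    using green_super_ge[of z "real n" x] z n h near zx by (auto simp: r_def)
  have S: "ln r \<le> ?S" "?S \<le> ln r + 1 / (4 * r\<^sup>2)"
    using log_sub_ge_ln[of "z - x"] log_sub_le[of "z - x"] zx by (auto simp: r_def)
  have U: "60 * ?U \<le> (1 - 60 / sqrt n) * ?P + 30 / sqrt n"
    using y by (intro sum_log_sub_le z n x) auto
  have V: "ln r + 1 / (4 * r\<^sup>2) - 60 / sqrt n * (ln n + 5) \<le> 60 * ?V"
  proof -
    have "ln r + 1 / (4 * r\<^sup>2) - 60 / sqrt n * (ln n + 5) \<le>
      60 * (\<Sum>j=3600..<n. weight j * (ln (1 + \<bar>r - nrm (y j - x)\<bar>) - 11 / (1 + \<bar>r - real j\<bar>)))"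
      using y near by (intro sum_weight_ln_minus_error_ge n r) (auto simp: r_def)
    also have "\<dots> \<le> 60 * ?V"
    proof (intro mult_left_mono sum_mono weight_nonneg log_super_ge)
      fix j assume "j \<in> {3600..<n}"
      show "\<bar>r - nrm (y j - x)\<bar> \<le> nrm (z - y j)"
        unfolding r_def by (rule nrm_diff_le)
    qed (use y in auto)
    finally show ?thesis .
  qed
  define q where "q = 60 / sqrt n"
  have q: "0 \<le> q" by (simp add: q_def)
  have "barrier x y n z = (1 + 9 * q) * (?P - ?S) - 60 * ?U + 60 * ?V"
    by (simp add: barrier_def green_super_def green_sub_def q_def right_diff_distrib sum_subtractf)
  moreover have "60 * ?U \<le> (1 - q) * ?P + q / 2" using U by (simp add: q_def)
  moreover have "?S - q * (ln n + 5) \<le> 60 * ?V" using V S by (simp add: q_def)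
  moreover have "(1 + 9 * q) * (?P - ?S) - ((1 - q) * ?P + q / 2) + (?S - q * (ln n + 5)) =
      q * (10 * ?K - 1 / 2 - ln n - 5 + ?S)"
    by (simp add: green_super_def algebra_simps)
  \<comment> \<open>One copy of \<open>?K\<close> together with \<open>?S\<close> dominates
    \<open>ln n\<close>; the other nine give at least 9 ln 2 >= 6, more than 5 + 1/2.\<close>
  moreover have "0 \<le> q * (10 * ?K - 1 / 2 - ln n - 5 + ?S)"
  proof (rule mult_nonneg_nonneg[OF q])
    have "(2 / 3 :: real) \<le> ln 2" by (rule ln2_ge_two_thirds)
    moreover have "(0 :: real) \<le> ln 8" by simp
    ultimately show "0 \<le> 10 * ?K - 1 / 2 - ln n - 5 + ?S" using K S by linarith
  qed
  ultimately show ?thesis by linarith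
qed

text \<open>\<open>log_sub\<close> equals - ln 2 / 2 at 0, and the \<open>y j\<close> are too far
  from \<open>x\<close> for their poles to contribute negatively. As \<open>n \<ge> 14400\<close>
  makes 60 / \<open>sqrt n\<close> at most 1/2, at least ln 2 / 4 survives.\<close>

lemma barrier_centre:
  assumes n: "14400 \<le> n" and x: "16 * int n \<le> snd x"
    and y: "\<And>j. 3600 \<le> j \<Longrightarrow> j < n \<Longrightarrow> real j \<le> nrm (y j - x) \<and> nrm (y j - x) < real j + 1"
  shows "1 / 6 \<le> barrier x y n x"
proof -
  let ?K = "green_super x x" and ?P = "log_super (x - mirror x)"
  let ?U = "\<Sum>j=3600..<n. weight j * log_sub (x - mirror (y j))"
  let ?V = "\<Sum>j=3600..<n. weight j * log_super (x - y j)"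
  have h: "16 * real n \<le> of_int (snd x)" using x by linarith
  have x0: "0 \<le> snd x" using x by linarith
  have K: "ln 2 \<le> ?K" using green_super_ge(1)[of x "real n" x] x0 n h by simp
  have S: "log_sub (x - x) = - ln 2 / 2" by (simp add: log_sub_def ln_div)
  have U: "60 * ?U \<le> (1 - 60 / sqrt n) * ?P + 30 / sqrt n"
    using y n by (intro sum_log_sub_le x x0) auto
  have V: "0 \<le> 60 * ?V"
  proof (intro mult_nonneg_nonneg sum_nonneg weight_nonneg)
    fix j assume j: "j \<in> {3600..<n}"
    have "ln 1 \<le> log_super (x - y j)"
      using y[of j] j by (intro ln_le_log_super) (auto simp: nrm_minus[of x])
    then show "0 \<le> log_super (x - y j)" by simp
  qed auto
  define q where "q = 60 / sqrt n"
  have "sqrt 14400 = (120 :: real)" by (rule real_sqrt_unique) auto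
  moreover have "sqrt 14400 \<le> sqrt n" using n by (intro real_sqrt_le_mono) auto
  ultimately have q: "0 \<le> q" "q \<le> 1 / 2" by (simp_all add: q_def divide_le_eq)
  have l: "(2 / 3 :: real) \<le> ln 2" by (rule ln2_ge_two_thirds)
  have PK: "?P = ?K - ln 2 / 2" using S by (simp add: green_super_def)
  have "barrier x y n x = (1 + 9 * q) * ?K - 60 * ?U + 60 * ?V"
    by (simp add: barrier_def green_sub_def q_def right_diff_distrib sum_subtractf)
  moreover have "60 * ?U \<le> (1 - q) * ?P + q / 2" using U by (simp add: q_def)
  moreover have "(1 + 9 * q) * ?K - ((1 - q) * ?P + q / 2) =
      q * (10 * ?K - 1 / 2) + (1 - q) * (ln 2 / 2)"
    by (simp add: PK algebra_simps)
  moreover have "0 \<le> q * (10 * ?K - 1 / 2)" using q K l by (intro mult_nonneg_nonneg) auto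
  moreover have "1 / 2 * (1 / 3) \<le> (1 - q) * (ln 2 / 2)" using q l by (intro mult_mono) auto
  ultimately show ?thesis using V by linarith
qed

section \<open>Sums of the Green kernel over a horizontal line\<close>

lemma sum_inverse_square_le:
  assumes "1 \<le> m"
  shows "(\<Sum>i\<le>M. 1 / (real i + real m)\<^sup>2) \<le> 2 / m - 1 / (real M + real m)"
proof (induction M)
  case 0
  have "1 / (real m)\<^sup>2 \<le> 1 / m" using assms by (simp add: power2_eq_square divide_le_cancel frac_le)
  then show ?case by simp
next
  case (Suc M)
  define u where "u = real M + real m"
  have u: "1 \<le> u" using assms by (simp add: u_def)
  have "1 / (u + 1)\<^sup>2 \<le> 1 / (u * (u + 1))"
    using u by (intro divide_left_mono) (auto simp: power2_eq_square)
  also have "\<dots> = 1 / u - 1 / (u + 1)" using u by (simp add: field_simps)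
  finally show ?case using Suc by (simp add: u_def add_ac)
qed

text \<open>By (|k| + m)^2 <= 2 (k^2 + m^2) the sum reduces to inverse squares, with the signs of
  \<open>k\<close> treated separately.\<close>

lemma sum_poisson_le:
  assumes "1 \<le> m" "finite (A :: int set)"
  shows "(\<Sum>k\<in>A. 1 / ((of_int k)\<^sup>2 + (real m)\<^sup>2)) \<le> 8 / m"
proof -
  let ?g = "\<lambda>i::nat. 1 / (real i + real m)\<^sup>2"
  have bound: "(\<Sum>i\<in>I. ?g i) \<le> 2 / m" if "finite I" for I
  proof -
    have "I \<subseteq> {..Max (insert 0 I)}" using that by auto
    then have "(\<Sum>i\<in>I. ?g i) \<le> (\<Sum>i\<le>Max (insert 0 I). ?g i)" by (intro sum_mono2) auto
    also have "\<dots> \<le> 2 / m - 1 / (real (Max (insert 0 I)) + real m)"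
      by (rule sum_inverse_square_le[OF assms(1)])
    also have "\<dots> \<le> 2 / m" by simp
    finally show ?thesis .
  qed
  have half: "(\<Sum>k\<in>I. 2 * ?g (nat \<bar>k\<bar>)) \<le> 4 / m" if "finite I" "inj_on (\<lambda>k. nat \<bar>k\<bar>) I" for I :: "int set"
  proof -
    have "(\<Sum>k\<in>I. ?g (nat \<bar>k\<bar>)) = (\<Sum>i\<in>(\<lambda>k. nat \<bar>k\<bar>) ` I. ?g i)"
      by (simp only: sum.reindex[OF that(2)] o_def)
    also have "\<dots> \<le> 2 / m" using that by (intro bound) auto
    finally show ?thesis unfolding sum_distrib_left[symmetric] by linarith
  qed
  have "(\<Sum>k\<in>A. 1 / ((of_int k)\<^sup>2 + (real m)\<^sup>2)) \<le> (\<Sum>k\<in>A. 2 * ?g (nat \<bar>k\<bar>))"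
  proof (rule sum_mono)
    fix k :: int
    define a where "a = real_of_int \<bar>k\<bar>"
    have m: "0 < real m" "0 \<le> a" using assms by (auto simp: a_def)
    have "0 \<le> (a - real m)\<^sup>2" by simp
    then have "(a + real m)\<^sup>2 / 2 \<le> a\<^sup>2 + (real m)\<^sup>2" by (simp add: power2_sum power2_diff)
    then have "1 / (a\<^sup>2 + (real m)\<^sup>2) \<le> 1 / ((a + real m)\<^sup>2 / 2)"
      using m by (intro divide_left_mono mult_pos_pos) (auto intro: add_nonneg_pos)
    then show "1 / ((of_int k)\<^sup>2 + (real m)\<^sup>2) \<le> 2 * ?g (nat \<bar>k\<bar>)"
      by (simp add: a_def)
  qed
  also have "\<dots> = (\<Sum>k\<in>A \<inter> {0..}. 2 * ?g (nat \<bar>k\<bar>)) + (\<Sum>k\<in>A - {0..}. 2 * ?g (nat \<bar>k\<bar>))"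
    by (rule sum.Int_Diff) (rule assms)
  also have "\<dots> \<le> 4 / m + 4 / m"
    using assms by (intro add_mono half) (auto simp: inj_on_def)
  finally show ?thesis by simp
qed

text \<open>ln (1 + t) <= t leaves a Poisson kernel at vertical distance \<open>m\<close>. As
  \<open>N\<close> is at least twice the height of \<open>x\<close>, \<open>m\<close> is at least N
  / 2 and the dependence on \<open>N\<close> cancels.\<close>

lemma sum_green_super_le:
  assumes x: "1 \<le> snd x" and N: "2 * snd x \<le> int N" and T: "finite T" "T \<subseteq> L N"
  shows "(\<Sum>z\<in>T. green_super x z) \<le> 128 * of_int (snd x)"
proof -
  let ?h = "real_of_int (snd x)"
  define m where "m = nat (int N - snd x)"
  have m: "1 \<le> m" "real m = real N - ?h" using x N by (auto simp: m_def of_nat_nat)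
  have h: "1 \<le> ?h" "2 * ?h \<le> real N" using x N by linarith+
  have inj: "inj_on (\<lambda>z. fst z - fst x) T"
    using T by (auto simp: inj_on_def L_def)
  have "green_super x z \<le> 2 * (real N + 1) * (?h + 1) * (1 / ((of_int (fst z - fst x))\<^sup>2 + (real m)\<^sup>2))"
    if "z \<in> T" for z
  proof -
    have z: "snd z = int N" using that T by (auto simp: L_def)
    let ?s = "4 * (real N + 1) * (?h + 1)" and ?d = "(nrm (z - x))\<^sup>2"
    have d: "?d = (of_int (fst z - fst x))\<^sup>2 + (real m)\<^sup>2"
      by (simp add: nrm_square z m)
    have d0: "0 < ?d" unfolding d using m by (intro add_nonneg_pos) auto
    have d1: "0 < ?d + 1 / 2" using d0 by linarith
    have s: "4 \<le> ?s" using four_le_heights[of z x] z x by simp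
    have "green_super x z = ln (1 + (?s - 1) / (?d + 1 / 2)) / 2"
      using green_super_eq[of z x] z x by simp
    also have "\<dots> \<le> (?s - 1) / (?d + 1 / 2) / 2"
      using s by (intro divide_right_mono ln_add_one_self_le_self divide_nonneg_pos d1) auto
    also have "\<dots> \<le> ?s / ?d / 2"
      using s by (intro divide_right_mono frac_le d0) auto
    also have "\<dots> = 2 * (real N + 1) * (?h + 1) * (1 / ?d)"
    proof -
      have "4 * a * b / c / 2 = 2 * a * b * (1 / c)" for a b c :: real by simp
      then show ?thesis .
    qed
    finally show ?thesis unfolding d .
  qed
  then have "(\<Sum>z\<in>T. green_super x z) \<le>
      (\<Sum>z\<in>T. 2 * (real N + 1) * (?h + 1) * (1 / ((of_int (fst z - fst x))\<^sup>2 + (real m)\<^sup>2)))"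
    by (rule sum_mono)
  also have "\<dots> = 2 * (real N + 1) * (?h + 1) *
      (\<Sum>k\<in>(\<lambda>z. fst z - fst x) ` T. 1 / ((of_int k)\<^sup>2 + (real m)\<^sup>2))"
    by (subst sum.reindex[OF inj]) (simp add: sum_distrib_left)
  also have "\<dots> \<le> 2 * (real N + 1) * (?h + 1) * (8 / m)"
    using T m h by (intro mult_left_mono sum_poisson_le) auto
  also have "\<dots> \<le> 2 * (2 * real N) * (2 * ?h) * (8 / (real N / 2))"
    using m h by (intro mult_mono divide_left_mono mult_pos_pos) auto
  also have "\<dots> = 128 * ?h" using h by (simp add: field_simps)
  finally show ?thesis .
qed

text \<open>Along a path in \<open>B\<close>, the distance to \<open>x\<close> changes by at most 1
  per step, so the first vertex at distance at least \<open>j\<close> is closer than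
  \<open>j + 1\<close>.\<close>

lemma ex_at_distance:
  assumes "lattice_connected B" "x \<in> B" "b \<in> B" "real j \<le> nrm (b - x)"
  shows "\<exists>y\<in>B. real j \<le> nrm (y - x) \<and> nrm (y - x) < real j + 1"
proof -
  have "(x, b) \<in> {(u, v). u \<in> B \<and> v \<in> B \<and> adjacent u v}\<^sup>*"
    using assms by (auto simp: lattice_connected_def)
  then show ?thesis using assms(4)
  proof (induction rule: rtrancl_induct)
    case base
    then show ?case using assms(2) by (intro bexI[of _ x]) auto
  next
    case (step u v)
    show ?case
    proof (cases "real j \<le> nrm (u - x)")
      case True
      then show ?thesis by (rule step.IH)
    next
      case False
      have "\<bar>nrm (u - x) - nrm (v - x)\<bar> \<le> 1"
        using nrm_diff_le[of u x v] nrm_adjacent[of u v] step.hyps by auto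
      then show ?thesis using False step by (intro bexI[of _ v]) auto
    qed
  qed
qed

theorem theorem1:
  shows "\<exists>(C :: real) (N0 :: int \<Rightarrow> nat). \<forall>B x1 x2 N.
    B \<subseteq> upper_half_plane \<and> lattice_connected B \<and> L 0 \<subseteq> B \<and> (x1, x2) \<in> B - L 0 \<and>
    N \<ge> 1 \<and> N \<ge> N0 x2 \<longrightarrow>
    H B N (x1, x2) \<le> ennreal (C * sqrt (real_of_int x2))"
\<comment> \<open>The barrier gives 6 * 840 * 128 * 6 = 3870720, and small heights give 256 * 480;
  both are below this constant.\<close>
proof (intro exI[of _ "4000000 :: real"] exI[of _ "\<lambda>h. nat (2 * h)"] allI impI, elim conjE)
  fix B x1 x2 N
  assume B: "B \<subseteq> upper_half_plane" "lattice_connected B" "L 0 \<subseteq> B"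
    and xB: "(x1, x2) \<in> B - L 0" and N0: "nat (2 * x2) \<le> N"
  define x where "x = (x1, x2)"
  have x2: "1 \<le> x2"
    using xB B(1) by (force simp: upper_half_plane_def L_def)
  then have x: "1 \<le> snd x" by (simp add: x_def)
  have N: "2 * snd x \<le> int N" using N0 by (simp add: x_def)
  let ?h = "real_of_int x2"
  let ?U = "{z :: point. 0 \<le> snd z}"
  \<comment> \<open>The walk can leave the half plane only from \<open>L 0\<close>, where it is
    already stopped.\<close>
  have U: "u \<in> ?U" if "z \<in> ?U" "z \<notin> B \<union> L 0" "adjacent z u" for z u
  proof -
    have "snd z \<noteq> 0" using that(2) by (cases z) (auto simp: L_def)
    then show ?thesis using that by (auto simp: adjacent_def)
  qed
  have LU: "L N \<subseteq> ?U" by (auto simp: L_def)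
  have h0: "0 \<le> ?h" "1 \<le> ?h" using x2 by simp_all
  show "H B N (x1, x2) \<le> ennreal (4000000 * sqrt ?h)"
  \<comment> \<open>230400 = 16 * 14400 = 480^2. Below it a bound linear in the height suffices,
    with \<open>green_super x\<close> itself as barrier.\<close>
  proof (cases "230400 \<le> x2")
    case False
    have K: "1 / 2 \<le> green_super x x"
    proof -
      \<comment> \<open>7 = 1 + (4 - 1) / (1/2) is the least argument of the logarithm allowed by
        \<open>four_le_heights\<close>.\<close>
      have "exp 1 \<le> (7 :: real)" using exp_le by simp
      then have "1 \<le> ln (7 :: real)" by (simp add: ln_ge_iff)
      also have "ln 7 \<le> ln (1 + (4 * (?h + 1) * (?h + 1) - 1) / (0\<^sup>2 + 1 / 2))"
        using four_le_heights[of x x] x by (intro ln_mono) (auto simp: x_def algebra_simps)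
      finally show ?thesis
        using green_super_eq[of x x] x by (simp add: x_def)
    qed
    have "H B N x \<le> ennreal (256 * ?h)"
    proof (rule H_le[where U = ?U and F = "green_super x"])
      fix T assume "finite T" "T \<subseteq> L N"
      then have "(\<Sum>z\<in>T. green_super x z) \<le> 128 * ?h"
        using sum_green_super_le[OF x N] by (simp add: x_def)
      also have "\<dots> \<le> 256 * ?h * green_super x x"
        using K h0 mult_left_mono[OF K, of "256 * ?h"] by simp
      finally show "(\<Sum>z\<in>T. green_super x z) \<le> 256 * ?h * green_super x x" .
    qed (use x K U LU in \<open>auto intro: green_super_nonneg green_super_superharmonic\<close>)
    also have "256 * ?h \<le> 4000000 * sqrt ?h"
    proof -
      have "sqrt ?h \<le> sqrt 230400" using False by (intro real_sqrt_le_mono) auto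
      also have "sqrt 230400 = (480 :: real)" by (rule real_sqrt_unique) auto
      finally have "sqrt ?h * sqrt ?h \<le> 480 * sqrt ?h" using h0 by (intro mult_right_mono) auto
      then show ?thesis using h0 by simp
    qed
    then have "ennreal (256 * ?h) \<le> ennreal (4000000 * sqrt ?h)" by (rule ennreal_leI)
    finally show ?thesis by (simp add: x_def)
  next
    case True
    define n where "n = nat (x2 div 16)"
    have n: "14400 \<le> n" "16 * int n \<le> snd x" "snd x \<le> 32 * int n"
      using True by (auto simp: n_def x_def)
    have n': "3600 \<le> n" using n by simp
    have "\<forall>j<n. \<exists>y\<in>B. real j \<le> nrm (y - x) \<and> nrm (y - x) < real j + 1"
    proof (intro allI impI)
      fix j assume "j < n"
      \<comment> \<open>The foot of \<open>x\<close> on \<open>L 0\<close> lies in \<open>B\<close>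
        at distance at least \<open>x2\<close>, so \<open>B\<close> meets every shell of radius
        below \<open>n\<close>.\<close>
      have "real n \<le> nrm ((x1, 0) - x)"
        using snd_le_nrm[of "(x1, 0) - x"] n by (simp add: x_def)
      then show "\<exists>y\<in>B. real j \<le> nrm (y - x) \<and> nrm (y - x) < real j + 1"
        using B xB \<open>j < n\<close> by (intro ex_at_distance[where b = "(x1, 0)"]) (auto simp: x_def L_def)
    qed
    then obtain y where y: "\<And>j. j < n \<Longrightarrow> y j \<in> B"
      "\<And>j. j < n \<Longrightarrow> real j \<le> nrm (y j - x) \<and> nrm (y j - x) < real j + 1"
      by metis
    have c: "1 / 6 \<le> barrier x y n x" using y by (intro barrier_centre n) auto
    have nonneg: "0 \<le> barrier x y n z" if "0 \<le> snd z" for z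
    proof -
      consider "z = x" | "z \<noteq> x" "nrm (z - x) \<le> 4 * real n" | "4 * real n \<le> nrm (z - x)" by linarith
      then show ?thesis
      proof cases
        case 1
        then show ?thesis using c by simp
      next
        case 2
        then show ?thesis using that y by (intro barrier_near n n') auto
      next
        case 3
        then show ?thesis using that y by (intro barrier_far(1) n n') auto
      qed
    qed
    have "H B N x \<le> ennreal (6 * (840 / sqrt n * (128 * ?h)))"
    proof (rule H_le[where U = ?U and F = "barrier x y n"])
      show "0 < barrier x y n x" using c by linarith
      show "nbr_sum (barrier x y n) z \<le> 4 * barrier x y n z" if "z \<in> ?U" "z \<notin> B \<union> L 0" for z
        using that x y by (intro barrier_superharmonic) auto
      fix T assume T: "finite T" "T \<subseteq> L N"
      have "(\<Sum>z\<in>T. barrier x y n z) \<le> (\<Sum>z\<in>T. 840 / sqrt n * green_super x z)"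
      proof (rule sum_mono)
        fix z assume "z \<in> T"
        then have z: "snd z = int N" using T by (auto simp: L_def)
        \<comment> \<open>The threshold on \<open>N\<close> puts all of \<open>L N\<close> in the
          far region of the barrier.\<close>
        have "int n * 4 \<le> snd z - snd x" using z N n by linarith
        then have "4 * real n \<le> nrm (z - x)" using snd_le_nrm[of "z - x"] by simp
        then show "barrier x y n z \<le> 840 / sqrt n * green_super x z"
          using z y by (intro barrier_far(2) n n') auto
      qed
      also have "\<dots> = 840 / sqrt n * (\<Sum>z\<in>T. green_super x z)" by (simp add: sum_distrib_left)
      also have "\<dots> \<le> 840 / sqrt n * (128 * ?h)"
        using sum_green_super_le[OF x N T] by (intro mult_left_mono) (auto simp: x_def)
      also have "\<dots> = 6 * (840 / sqrt n * (128 * ?h)) * (1 / 6)" by simp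
      also have "\<dots> \<le> 6 * (840 / sqrt n * (128 * ?h)) * barrier x y n x"
        using c h0 by (intro mult_left_mono) auto
      finally show "(\<Sum>z\<in>T. barrier x y n z) \<le> 6 * (840 / sqrt n * (128 * ?h)) * barrier x y n x" .
    qed (use nonneg U LU in auto)
    also have "6 * (840 / sqrt n * (128 * ?h)) \<le> 4000000 * sqrt ?h"
    proof -
      \<comment> \<open>32 is rounded up to the square 36.\<close>
      have "?h \<le> 36 * real n" using n by (simp add: x_def)
      then have "sqrt ?h \<le> sqrt (36 * real n)" by (rule real_sqrt_le_mono)
      also have "\<dots> = 6 * sqrt n" by (simp add: real_sqrt_mult real_sqrt_unique)
      finally have "sqrt ?h / sqrt n \<le> 6" using n by (simp add: divide_le_eq)
      then have "645120 * sqrt ?h * (sqrt ?h / sqrt n) \<le> 645120 * sqrt ?h * 6"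
        using h0 by (intro mult_left_mono) auto
      moreover have "645120 * sqrt ?h * (sqrt ?h / sqrt n) = 6 * (840 / sqrt n * (128 * ?h))"
        using h0 by simp
      moreover have "0 \<le> sqrt ?h" using h0 by simp
      ultimately show ?thesis by linarith
    qed
    then have "ennreal (6 * (840 / sqrt n * (128 * ?h))) \<le> ennreal (4000000 * sqrt ?h)"
      by (rule ennreal_leI)
    finally show ?thesis by (simp add: x_def)
  qed
qed

end
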